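(* Let $T$ be an action of a countable abelian group $G$ and let $H$ be a subgroup of $G$. If $\overline{\{T_g:g\in G\}}=\overline{\{T_h:h\in H\}}$ (closures in $\Omega$), then $T$ is a locally dense point for the restriction map $\pi_H:\Omega_G\to\Omega_H$, $\pi_H(S)=S|_H$.
   Context: $(X,\mathcal{F},\mu)$ is a standard atomless Borel probability space; $\Omega$ is the group of its invertible measure-preserving transformations (mod null sets) with the weak topology ($T_n\to T$ iff $\mu(T_nA\Delta TA)\to0$ for all measurable $A$). For a countable group $K$, $\Omega_K$ is the Polish space of $K$-actions (homomorphisms $K\to\Omega$) with the topology of pointwise convergence on $K$. For a continuous map $\varphi:Y\to Z$ of Polish spaces, $y\in Y$ is a locally dense point of $\varphi$ if for every neighborhood $U$ of $y$, $\varphi(U)$ is dense in some neighborhood of $\varphi(y)$. *)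

theory Defs
  imports "HOL-Probability.Probability"
begin

definition mp :: "'a measure \<Rightarrow> ('a \<Rightarrow> 'a) \<Rightarrow> bool" where
  "mp M f \<longleftrightarrow> f \<in> M \<rightarrow>\<^sub>M M \<and> distr M M f = M"

text \<open>Invertible measure-preserving transformations, taken modulo null sets:
  a representative is a measure-preserving map having a measure-preserving
  inverse modulo null sets.\<close>
definition Aut :: "'a measure \<Rightarrow> ('a \<Rightarrow> 'a) set" where
  "Aut M = {f. mp M f \<and> (\<exists>g. mp M g \<and> (AE x in M. g (f x) = x) \<and> (AE x in M. f (g x) = x))}"

text \<open>A (chosen) inverse mod null sets; any two choices agree almost everywhere.\<close>
definition inv_aut :: "'a measure \<Rightarrow> ('a \<Rightarrow> 'a) \<Rightarrow> ('a \<Rightarrow> 'a)" where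
  "inv_aut M f = (SOME g. mp M g \<and> (AE x in M. g (f x) = x) \<and> (AE x in M. f (g x) = x))"

definition img :: "'a measure \<Rightarrow> ('a \<Rightarrow> 'a) \<Rightarrow> 'a set \<Rightarrow> 'a set" where
  "img M f A = inv_aut M f -` A \<inter> space M"

text \<open>Weak topology on Aut: T_n \<rightarrow> T iff mu(T_n A \<Delta> T A) \<rightarrow> 0 for all measurable A.
  It is generated by the sets {S. mu(S A \<Delta> T A) < e}.\<close>
definition weak_top :: "'a measure \<Rightarrow> ('a \<Rightarrow> 'a) topology" where
  "weak_top M = topology_generated_by
     (insert (Aut M) {{S \<in> Aut M. measure M (sym_diff (img M S A) (img M T A)) < e} | T A e.
        T \<in> Aut M \<and> A \<in> sets M \<and> e > 0})"

text \<open>Actions of a subgroup K (given as a subset of the ambient group type) on (X,mu):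
  homomorphisms K \<rightarrow> Aut, i.e. T_{g+h} = T_g T_h mod null sets.
  Functions are extensional (undefined outside K).\<close>
definition actions :: "'a measure \<Rightarrow> 'g::ab_group_add set \<Rightarrow> ('g \<Rightarrow> 'a \<Rightarrow> 'a) set" where
  "actions M K = {T \<in> PiE K (\<lambda>_. Aut M).
     \<forall>g\<in>K. \<forall>h\<in>K. AE x in M. T (g + h) x = T g (T h x)}"

definition actions_top :: "'a measure \<Rightarrow> 'g::ab_group_add set \<Rightarrow> ('g \<Rightarrow> 'a \<Rightarrow> 'a) topology" where
  "actions_top M K = subtopology (product_topology (\<lambda>_. weak_top M) K) (actions M K)"

definition locally_dense_point :: "'y topology \<Rightarrow> 'z topology \<Rightarrow> ('y \<Rightarrow> 'z) \<Rightarrow> 'y \<Rightarrow> bool" where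
  "locally_dense_point Y Z \<phi> y \<longleftrightarrow>
     (\<forall>U. openin Y U \<and> y \<in> U \<longrightarrow>
        (\<exists>V. openin Z V \<and> \<phi> y \<in> V \<and> V \<subseteq> Z closure_of (\<phi> ` U \<inter> V)))"

definition std_atomless_prob :: "'a::polish_space measure \<Rightarrow> bool" where
  "std_atomless_prob M \<longleftrightarrow> prob_space M \<and> sets M = sets borel \<and> (\<forall>x. emeasure M {x} = 0)"

end

theory Submission
  imports Defs
begin

text \<open>Every coset of \<open>H\<close> contains elements \<open>s\<close> for which \<open>T s\<close> is weakly close to the identity. Let \<open>L\<close> be
  a subgroup containing \<open>H\<close> with finite index, and let \<open>Z\<close> be a transversal of \<open>H\<close> in \<open>L\<close> made of such
  elements. Inducing an \<open>H\<close>-action \<open>S\<close> to \<open>L\<close> gives an action on \<open>X \<times> Z\<close>; because the group is abelian, its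
  restriction to \<open>H\<close> is \<open>S \<times> id\<close>, and \<open>g \<in> L\<close> acts through elements \<open>S (g + q - q')\<close> with \<open>q, q' \<in> Z\<close>, which
  are close to \<open>T g\<close> as soon as \<open>S\<close> is close to \<open>T\<close> on \<open>H\<close>. An isomorphism \<open>X \<times> Z \<rightarrow> X\<close> that is compatible with the
  projection to \<open>X\<close> on a given finite family of sets moves this action to \<open>X\<close>. If instead \<open>L\<close> is generated over \<open>H\<close>
  by a free element, \<open>S\<close> extends through a retraction of \<open>L\<close> onto \<open>H\<close>. This handles all \<open>L\<close> finitely generated
  over \<open>H\<close>, and a neighbourhood of \<open>T\<close> only involves such an \<open>L\<close>; the extension from \<open>L\<close> to the whole
  group is unconstrained and is obtained by coinduction to a product space, again moved to \<open>X\<close>.\<close>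

section \<open>Polish spaces as Borel retracts of the real line\<close>

text \<open>\<open>f\<close> encodes the points as reals and \<open>g\<close> decodes them. This
  one-sided form passes easily to products with a countable set; for atomless probability measures
  it is later upgraded to an isomorphism with the unit interval modulo null sets.\<close>

definition encodable :: "'a measure \<Rightarrow> bool" where
  "encodable N \<longleftrightarrow> (\<exists>f g. f \<in> borel_measurable N \<and> g \<in> (borel :: real measure) \<rightarrow>\<^sub>M N \<and>
     (\<forall>y\<in>space N. g (f y) = y))"

text \<open>Base 4 with digits 0 and 1 only: expansions are unique, so each digit can be recovered
  from the value.\<close>

definition bits_real :: "(nat \<Rightarrow> bool) \<Rightarrow> real" where
  "bits_real b = (\<Sum>n. of_bool (b n) * (1/4) ^ Suc n)"

text \<open>The digit is read after \<open>n\<close> iterations of the shift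
  \<open>s \<mapsto> frac (4 * s)\<close>.\<close>

definition bit_of :: "nat \<Rightarrow> real \<Rightarrow> bool" where
  "bit_of n t \<longleftrightarrow> \<lfloor>4 * ((\<lambda>s. frac (4 * s)) ^^ n) t\<rfloor> = 1"

lemma summable_bits: "summable (\<lambda>n. of_bool (b n) * (1/4 :: real) ^ Suc n)"
  by (rule summable_comparison_test'[where g="\<lambda>n. (1/4 :: real) ^ Suc n" and N=0])
     (auto simp del: power_Suc intro!: summable_Suc_iff[THEN iffD2] summable_geometric)

lemma bits_real_bounds: "0 \<le> bits_real b" "bits_real b < 1"
proof -
  show "0 \<le> bits_real b"
    unfolding bits_real_def by (rule suminf_nonneg[OF summable_bits]) auto
  have s: "(\<lambda>n. (1/4 :: real) ^ Suc n) sums (1/4 * (1 / (1 - 1/4)))"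
    using sums_mult[OF geometric_sums[of "1/4::real"], of "1/4"] by simp
  have "bits_real b \<le> (\<Sum>n. (1/4 :: real) ^ Suc n)"
    unfolding bits_real_def
    by (rule suminf_le[OF _ summable_bits sums_summable[OF s]]) auto
  also have "\<dots> < 1" using sums_unique[OF s] by simp
  finally show "bits_real b < 1" .
qed

lemma bits_real_shift: "4 * bits_real b = of_bool (b 0) + bits_real (\<lambda>n. b (Suc n))"
proof -
  have "bits_real b = of_bool (b 0) * (1/4) + (\<Sum>n. of_bool (b (Suc n)) * (1/4) ^ Suc (Suc n))"
    using suminf_split_head[OF summable_bits[of b]] unfolding bits_real_def by simp
  also have "(\<Sum>n. of_bool (b (Suc n)) * (1/4 :: real) ^ Suc (Suc n))
      = (1/4) * bits_real (\<lambda>n. b (Suc n))"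
    unfolding bits_real_def
    by (subst suminf_mult[OF summable_bits, symmetric]) (simp add: mult_ac)
  finally show ?thesis by simp
qed

lemma bit_of_bits_real: "bit_of n (bits_real b) = b n"
proof (induction n arbitrary: b)
  case 0
  show ?case
    using bits_real_bounds[of "\<lambda>n. b (Suc n)"]
    by (cases "b 0") (auto simp: bit_of_def bits_real_shift floor_eq_iff)
next
  case (Suc n)
  have "frac (4 * bits_real b) = bits_real (\<lambda>n. b (Suc n))"
    using bits_real_bounds[of "\<lambda>n. b (Suc n)"]
    by (cases "b 0") (auto simp: bits_real_shift frac_eq frac_unique_iff)
  then have "bit_of (Suc n) (bits_real b) = bit_of n (bits_real (\<lambda>n. b (Suc n)))"
    by (simp only: bit_of_def funpow_Suc_right o_apply)
  with Suc show ?case by simp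
qed

lemma measurable_bit_of [measurable]: "Measurable.pred borel (bit_of n)"
proof -
  have [measurable]: "((\<lambda>s::real. frac (4 * s)) ^^ n) \<in> borel_measurable borel" for n
    by (induction n) (auto simp: frac_def id_def)
  show ?thesis unfolding bit_of_def by measurable
qed

text \<open>A point is coded by the answers to all questions "is the distance to \<open>d i\<close>
  less than \<open>1 / Suc k\<close>", where \<open>d\<close> is a dense sequence. Decoding takes,
  for each \<open>k\<close>, the first \<open>d i\<close> with a positive answer, and lets
  \<open>k\<close> tend to infinity.\<close>

lemma encodable_polish:
  fixes N :: "'a::polish_space measure"
  assumes N: "sets N = sets borel"
  shows "encodable N"
proof -
  obtain D :: "'a set" where D: "countable D" "\<And>X. open X \<Longrightarrow> X \<noteq> {} \<Longrightarrow> \<exists>d\<in>D. d \<in> X"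
    using countable_dense_setE by blast
  then have "D \<noteq> {}" by (metis empty_iff open_UNIV UNIV_not_empty)
  then obtain d :: "nat \<Rightarrow> 'a" where d: "range d = D"
    using D(1) uncountable_def by metis
  define b where "b x m = (case prod_decode m of (i, k) \<Rightarrow> dist x (d i) < 1 / Suc k)" for x m
  define g where "g k t = d (LEAST i. bit_of (prod_encode (i, k)) t)" for k t
  \<comment> \<open>The default \<open>d 0\<close> makes the sequence converge at every real, also
    at those that code no point, so the limit is Borel on the whole line.\<close>
  define g' where "g' k t = (if Cauchy (\<lambda>k. g k t) then g k t else d 0)" for k t
  have [measurable]: "(\<lambda>x. b x m) \<in> borel \<rightarrow>\<^sub>M count_space UNIV" for m
    unfolding b_def by (cases "prod_decode m") simp
  have 1: "(\<lambda>x. bits_real (b x)) \<in> borel_measurable borel"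
    unfolding bits_real_def of_bool_def by measurable
  have [measurable]: "g k \<in> borel_measurable borel" for k
    unfolding g_def by measurable
  have [measurable]: "g' k \<in> borel_measurable borel" for k
    unfolding g'_def by measurable
  have "convergent (\<lambda>k. g' k t)" for t
  proof (cases "Cauchy (\<lambda>k. g k t)")
    case True
    then show ?thesis unfolding g'_def if_P[OF True] by (rule Cauchy_convergent)
  next
    case False
    show ?thesis unfolding g'_def if_not_P[OF False] by (rule convergent_const)
  qed
  then have "(\<lambda>k. g' k t) \<longlonglongrightarrow> lim (\<lambda>k. g' k t)" for t
    unfolding convergent_LIMSEQ_iff .
  then have 2: "(\<lambda>t. lim (\<lambda>k. g' k t)) \<in> borel_measurable borel"
    by (rule borel_measurable_LIMSEQ_metric[rotated]) simp
  have "lim (\<lambda>k. g' k (bits_real (b x))) = x" for x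
  proof -
    have "dist (g k (bits_real (b x))) x < 1 / Suc k" for k
    proof -
      have "\<exists>i. dist x (d i) < 1 / Suc k"
        using D(2)[of "ball x (1 / Suc k)"] d by (auto simp: image_iff)
      then have "dist x (d (LEAST i. dist x (d i) < 1 / Suc k)) < 1 / Suc k"
        by (rule LeastI_ex)
      then show ?thesis
        by (simp add: g_def bit_of_bits_real b_def dist_commute)
    qed
    then have "(\<lambda>k. dist (g k (bits_real (b x))) x) \<longlonglongrightarrow> 0"
      by (intro tendsto_sandwich[OF _ _ tendsto_const LIMSEQ_inverse_real_of_nat])
         (auto simp: inverse_eq_divide less_imp_le)
    then have *: "(\<lambda>k. g k (bits_real (b x))) \<longlonglongrightarrow> x"
      using tendsto_dist_iff by blast
    then have "Cauchy (\<lambda>k. g k (bits_real (b x)))"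
      by (rule LIMSEQ_imp_Cauchy)
    with * show ?thesis by (simp add: g'_def limI)
  qed
  with 1 2 show ?thesis
    unfolding encodable_def
    using measurable_cong_sets[OF N refl] measurable_cong_sets[OF refl N] by blast
qed

text \<open>The copy with index \<open>i\<close> is placed in the open interval from
  \<open>to_nat i\<close> to \<open>to_nat i + 1\<close>: the integer part returns the index, and
  the fractional part returns the point through \<open>arctan\<close>.\<close>

lemma encodable_pair_countable:
  assumes "encodable (N :: 'a measure)"
  shows "encodable (N \<Otimes>\<^sub>M count_space (UNIV :: 'i::countable set))"
proof -
  obtain f g where f [measurable]: "f \<in> borel_measurable N"
    and g [measurable]: "g \<in> (borel :: real measure) \<rightarrow>\<^sub>M N" and gf: "\<And>y. y \<in> space N \<Longrightarrow> g (f y) = y"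
    using assms unfolding encodable_def by blast
  define F where "F z = real (to_nat (snd z)) + (arctan (f (fst z)) / pi + 1/2)" for z :: "'a \<times> 'i"
  define G where "G t = (g (tan (pi * (frac t - 1/2))), from_nat (nat \<lfloor>t\<rfloor>) :: 'i)" for t
  have [measurable]: "arctan \<in> borel_measurable borel" "tan \<in> borel_measurable (borel :: real measure)"
    unfolding tan_def by (auto intro!: borel_measurable_continuous_onI continuous_intros)
  have [measurable]: "frac \<in> borel_measurable (borel :: real measure)"
    unfolding frac_def by measurable
  have "F \<in> borel_measurable (N \<Otimes>\<^sub>M count_space UNIV)" unfolding F_def by measurable
  moreover have "G \<in> borel \<rightarrow>\<^sub>M N \<Otimes>\<^sub>M count_space UNIV" unfolding G_def by measurable
  moreover have "G (F z) = z" if "z \<in> space (N \<Otimes>\<^sub>M count_space UNIV)" for z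
  proof -
    let ?s = "arctan (f (fst z)) / pi + 1/2"
    have "0 < ?s" "?s < 1"
      using arctan_bounded[of "f (fst z)"] pi_gt_zero by (auto simp: field_simps)
    then have "\<lfloor>F z\<rfloor> = int (to_nat (snd z))" "frac (F z) = ?s"
      by (auto simp: F_def floor_eq_iff frac_unique_iff)
    moreover have "g (f (fst z)) = fst z" using that by (auto simp: space_pair_measure intro!: gf)
    ultimately show ?thesis by (simp add: G_def tan_arctan)
  qed
  ultimately show ?thesis unfolding encodable_def by blast
qed

section \<open>Atomless probability spaces and the unit interval\<close>

abbreviation unif :: "real measure" where
  "unif \<equiv> restrict_space lborel {0<..<1}"

text \<open>Without atoms the distribution function is continuous, so its pseudoinverse, the
  quantile function, is an exact right inverse.\<close>

lemma atomless_quantile: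
  assumes "real_distribution \<nu>" and atomless: "\<And>t. emeasure \<nu> {t} = 0"
  obtains I where "I \<in> unif \<rightarrow>\<^sub>M borel" "distr unif borel I = \<nu>"
    "\<And>t. 0 < t \<Longrightarrow> t < 1 \<Longrightarrow> cdf \<nu> (I t) = t"
proof -
  interpret real_distribution \<nu> by fact
  interpret cdf_distribution \<nu> by standard
  have cont: "isCont C t" for t
    unfolding isCont_cdf by (simp only: measure_def enn2real_0 atomless)
  have CI: "C (I t) = t" if t: "0 < t" "t < 1" for t
  proof (rule antisym)
    show "t \<le> C (I t)" by (rule pseudoinverse[OF t, THEN iffD2]) (rule order_refl)
    \<comment> \<open>Otherwise continuity yields some \<open>x < I t\<close> with
      \<open>t < C x\<close>, while the Galois property of the pseudoinverse gives
      \<open>I t \<le> x\<close>.\<close>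
    show "C (I t) \<le> t"
    proof (rule ccontr)
      assume "\<not> C (I t) \<le> t"
      then have "eventually (\<lambda>x. t < C x) (at_left (I t))"
        using cont[of "I t"] unfolding isCont_def
        by (intro order_tendstoD(1)[OF tendsto_within_subset]) auto
      moreover have "eventually (\<lambda>x. x < I t) (at_left (I t))"
        by (simp add: eventually_at_filter)
      ultimately have "eventually (\<lambda>x. False) (at_left (I t))"
      proof eventually_elim
        case (elim x)
        then have "I t \<le> x" by (intro pseudoinverse[OF t, THEN iffD1] less_imp_le)
        with elim(2) show False by (metis not_less)
      qed
      then show False by (simp add: trivial_limit_at_left_real)
    qed
  qed
  have "I \<in> unif \<rightarrow>\<^sub>M borel"
    using measurable_CI by (simp add: measurable_def space_restrict_space sets_restrict_space)
  then show ?thesis using that[OF _ distr_I_eq_M CI] by blast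
qed

text \<open>The encoding \<open>F\<close> sorts the points by their label \<open>b\<close> first, so that the label can be read off from
  the uniform coordinate.\<close>
lemma label_uniformize:
  fixes N :: "'a measure" and b :: "'a \<Rightarrow> nat"
  assumes N: "prob_space N" and enc: "encodable N"
    and b [measurable]: "b \<in> N \<rightarrow>\<^sub>M count_space UNIV"
    and atomless: "\<And>y. y \<in> space N \<Longrightarrow> emeasure N {y} = 0"
  obtains u v where "u \<in> N \<rightarrow>\<^sub>M unif" "v \<in> unif \<rightarrow>\<^sub>M N" "distr N unif u = unif" "distr unif N v = N"
    "AE y in N. v (u y) = y" "AE t in unif. u (v t) = t"
    "AE y in N. measure N {z\<in>space N. b z < b y} < u y \<and> u y < measure N {z\<in>space N. b z < Suc (b y)}"
proof -
  interpret N: prob_space N by fact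
  interpret U: prob_space unif
    by (auto simp add: emeasure_restrict_space space_restrict_space intro!: prob_spaceI)
  have sp_U: "space unif = {0<..<1}" by (simp add: space_restrict_space)
  obtain f g where f [measurable]: "f \<in> borel_measurable N"
    and g [measurable]: "g \<in> (borel :: real measure) \<rightarrow>\<^sub>M N" and gf: "\<And>y. y \<in> space N \<Longrightarrow> g (f y) = y"
    using enc unfolding encodable_def by blast
  define F where "F y = real (b y) + (arctan (f y) / pi + 1/2)" for y
  define G where "G t = g (tan (pi * (frac t - 1/2)))" for t
  have [measurable]: "arctan \<in> borel_measurable borel" "tan \<in> borel_measurable (borel :: real measure)"
    unfolding tan_def by (auto intro!: borel_measurable_continuous_onI continuous_intros)
  have [measurable]: "frac \<in> borel_measurable (borel :: real measure)"
    unfolding frac_def by measurable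
  have F [measurable]: "F \<in> borel_measurable N" unfolding F_def by measurable
  have G [measurable]: "G \<in> borel \<rightarrow>\<^sub>M N" unfolding G_def by measurable
  have F_bounds: "real (b y) < F y" "F y < real (b y) + 1" for y
    using arctan_bounded[of "f y"] pi_gt_zero by (auto simp: F_def field_simps)
  have GF: "G (F y) = y" if "y \<in> space N" for y
  proof -
    have "frac (F y) = arctan (f y) / pi + 1/2"
      using F_bounds[of y] by (auto simp: F_def frac_unique_iff)
    then show ?thesis using gf[OF that] by (simp add: G_def tan_arctan)
  qed
  define \<nu> where "\<nu> = distr N borel F"
  have sets_\<nu> [measurable_cong]: "sets \<nu> = sets borel" by (simp add: \<nu>_def)
  interpret real_distribution \<nu>
    unfolding \<nu>_def by (rule N.real_distribution_distr) simp
  have "emeasure \<nu> {t} = 0" for t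
  proof (cases "\<exists>y\<in>space N. F y = t")
    case True
    then obtain y where y: "y \<in> space N" "F y = t" by blast
    have "z = y" if "z \<in> space N" "F z = t" for z using GF that y by metis
    then have "F -` {t} \<inter> space N = {y}" using y by blast
    with atomless[OF y(1)] have "emeasure N (F -` {t} \<inter> space N) = 0" by (simp only:)
    then show ?thesis
      unfolding \<nu>_def emeasure_distr[OF F borel_singleton[OF sets.empty_sets]] .
  next
    case False
    then have "F -` {t} \<inter> space N = {}" by auto
    then show ?thesis by (simp add: \<nu>_def emeasure_distr)
  qed
  then obtain I where I [measurable]: "I \<in> unif \<rightarrow>\<^sub>M borel" and dI: "distr unif borel I = \<nu>"
    and CI: "\<And>t. 0 < t \<Longrightarrow> t < 1 \<Longrightarrow> cdf \<nu> (I t) = t"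
    using atomless_quantile[OF real_distribution_axioms] by blast
  define C where "C = cdf \<nu>"
  note CI = CI[folded C_def]
  have C_mono: "C s \<le> C t" if "s \<le> t" for s t
    unfolding C_def using that by (rule cdf_nondecreasing)
  have [measurable]: "C \<in> borel_measurable borel"
    by (intro borel_measurable_mono monoI C_mono)
  \<comment> \<open>The default \<open>1/2\<close> keeps the values of \<open>u\<close> in the open
    interval everywhere. As \<open>u\<close> will have uniform distribution, it takes this value
    only on a null set.\<close>
  define u where "u y = (let c = C (F y) in if 0 < c \<and> c < 1 then c else 1/2)" for y
  define v where "v t = G (I t)" for t
  have u0: "u \<in> borel_measurable N" unfolding u_def Let_def by measurable
  have u [measurable]: "u \<in> N \<rightarrow>\<^sub>M unif"
    by (intro measurable_restrict_space2) (use u0 in \<open>auto simp: u_def Let_def\<close>)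
  have v [measurable]: "v \<in> unif \<rightarrow>\<^sub>M N" unfolding v_def by measurable
  have "distr unif N v = distr \<nu> N G"
    unfolding dI[symmetric] v_def by (subst distr_distr) (auto simp: comp_def)
  also have "\<dots> = distr N N (\<lambda>y. G (F y))"
    unfolding \<nu>_def by (subst distr_distr) (auto simp: comp_def)
  also have "\<dots> = distr N N (\<lambda>y. y)"
    by (rule distr_cong) (auto simp: GF)
  finally have dv: "distr unif N v = N" by simp
  have "AE s in \<nu>. F (G s) = s"
    unfolding \<nu>_def by (subst AE_distr_iff) (auto simp: GF)
  then have "AE t in unif. F (G (I t)) = I t"
    unfolding dI[symmetric] by (subst (asm) AE_distr_iff) auto
  then have uv: "AE t in unif. u (v t) = t"
  proof (rule AE_mp, intro AE_I2 impI)
    fix t assume "t \<in> space unif" "F (G (I t)) = I t"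
    then show "u (v t) = t" by (simp add: sp_U u_def v_def CI)
  qed
  have AE_U: "AE y in N. P (u y)" if "AE t in unif. P t" "Measurable.pred unif P" for P
  proof -
    have "AE t in unif. P (u (v t))" using uv that(1) by eventually_elim simp
    then have "AE y in distr unif N v. P (u y)"
      using that(2) by (subst AE_distr_iff) auto
    then show ?thesis unfolding dv .
  qed
  \<comment> \<open>The identity is composed with \<open>f\<close> because equality of real
    functions is measurable, which the transfer along \<open>v\<close> requires; injectivity of
    \<open>f\<close> on \<open>N\<close> then removes it.\<close>
  have "AE t in unif. f (v (u (v t))) = f (v t)" using uv by eventually_elim simp
  then have "AE y in distr unif N v. f (v (u y)) = f y" by (subst AE_distr_iff) auto
  then have vu: "AE y in N. v (u y) = y"
    unfolding dv
  proof (rule AE_mp, intro AE_I2 impI)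
    fix y assume y: "y \<in> space N" and "f (v (u y)) = f y"
    moreover have "v (u y) \<in> space N" using y by (meson u v measurable_space)
    ultimately show "v (u y) = y" using gf by metis
  qed
  have "distr N unif u = distr unif unif (\<lambda>t. u (v t))"
    by (subst (1) dv[symmetric], subst distr_distr) (auto simp: comp_def)
  also have "\<dots> = distr unif unif (\<lambda>t. t)"
    using uv by (intro distr_cong_AE) auto
  finally have du: "distr N unif u = unif" by simp
  \<comment> \<open>\<open>F\<close> maps the points with label \<open>k\<close> strictly between
    \<open>k\<close> and \<open>k + 1\<close>, so integers separate the labels.\<close>
  have C_b: "measure N {z\<in>space N. b z < k} = C (real k)" for k
  proof -
    have "(F z \<le> real k) = (b z < k)" for z
      using F_bounds[of z] by linarith
    then show ?thesis
      unfolding C_def cdf_def \<nu>_def by (subst measure_distr) (auto intro!: arg_cong[where f="measure N"])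
  qed
  have ne: "AE t in unif. t \<noteq> c" for c
    by (subst AE_restrict_space_iff) (use AE_lborel_singleton[of c] in auto)
  have "Measurable.pred borel (\<lambda>t::real. t \<noteq> c)" for c by measurable
  then have [measurable]: "Measurable.pred unif (\<lambda>t. t \<noteq> c)" for c
    by (intro measurable_restrict_space1) simp
  \<comment> \<open>Avoiding the countably many thresholds \<open>C (real k)\<close> almost
    everywhere turns the weak inequalities for the label into strict ones.\<close>
  have "AE y in N. u y \<noteq> c" for c
    by (intro AE_U ne) measurable
  then have "AE y in N. u y \<noteq> 1/2 \<and> (\<forall>k. u y \<noteq> C (real k))"
    by (intro AE_conjI AE_all_countable[THEN iffD2] allI)
  then have lab: "AE y in N. measure N {z\<in>space N. b z < b y} < u y \<and> u y < measure N {z\<in>space N. b z < Suc (b y)}"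
  proof (rule AE_mp, intro AE_I2 impI)
    fix y assume *: "u y \<noteq> 1/2 \<and> (\<forall>k. u y \<noteq> C (real k))"
    then have "u y = C (F y)" by (auto simp: u_def Let_def split: if_splits)
    moreover have "C (real (b y)) \<le> C (F y)" "C (F y) \<le> C (real (Suc (b y)))"
      using F_bounds[of y] by (auto intro!: C_mono)
    ultimately show "measure N {z\<in>space N. b z < b y} < u y \<and> u y < measure N {z\<in>space N. b z < Suc (b y)}"
      using * unfolding C_b by (metis less_le)
  qed
  show ?thesis using that[OF u v du dv vu uv lab] .
qed

text \<open>Membership in each further set is appended to the label as a new lowest binary
  digit.\<close>

lemma finite_family_label:
  assumes "finite \<B>" "\<B> \<subseteq> sets M"
  shows "\<exists>b \<in> M \<rightarrow>\<^sub>M count_space (UNIV :: nat set). \<forall>A\<in>\<B>. \<exists>J. \<forall>x. x \<in> A \<longleftrightarrow> b x \<in> J"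
  using assms
proof (induction rule: finite_induct)
  case empty
  show ?case by (intro bexI[of _ "\<lambda>_. 0"]) auto
next
  case (insert A \<B>)
  then obtain b :: "'a \<Rightarrow> nat" where b [measurable]: "b \<in> M \<rightarrow>\<^sub>M count_space UNIV"
    and J: "\<forall>A\<in>\<B>. \<exists>J. \<forall>x. x \<in> A \<longleftrightarrow> b x \<in> J"
    by auto
  have [measurable]: "A \<in> sets M" using insert by simp
  define b' where "b' x = 2 * b x + of_bool (x \<in> A)" for x
  have "b' \<in> M \<rightarrow>\<^sub>M count_space UNIV"
    unfolding b'_def of_bool_def by measurable
  moreover have "\<exists>J. \<forall>x. x \<in> B \<longleftrightarrow> b' x \<in> J" if B: "B \<in> insert A \<B>" for B
  proof (cases "B = A")
    case True
    then show ?thesis by (intro exI[of _ "{n. odd n}"]) (auto simp: b'_def)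
  next
    case False
    then obtain J where J: "\<forall>x. x \<in> B \<longleftrightarrow> b x \<in> J" using J B by blast
    moreover have "b' x div 2 = b x" for x by (simp add: b'_def)
    ultimately show ?thesis by (intro exI[of _ "{n. n div 2 \<in> J}"]) simp
  qed
  ultimately show ?case by blast
qed

lemma AE_pullback:
  assumes "f \<in> M \<rightarrow>\<^sub>M N" "distr M N f = N" "AE y in N. P y"
  shows "AE x in M. P (f x)"
  by (rule AE_distrD[OF assms(1)]) (simp only: assms)

text \<open>\<open>M\<close> with a label \<open>b\<close> recording membership in the sets of
  \<open>\<B>\<close>, and \<open>N\<close> with the label \<open>b \<circ> p\<close>, have labels
  of the same distribution. Both are uniformized with labels sorted; equal uniform coordinates then
  carry equal labels, so \<open>\<phi>\<close> agrees with \<open>p\<close> as far as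
  \<open>\<B>\<close> can see.\<close>

lemma relabel_iso:
  fixes N :: "'b measure" and M :: "'a measure"
  assumes N: "prob_space N" "encodable N" and M: "prob_space M" "encodable M"
    and atomless: "\<And>x. x \<in> space M \<Longrightarrow> emeasure M {x} = 0"
    and p [measurable]: "p \<in> N \<rightarrow>\<^sub>M M" and dp: "distr N M p = M"
    and \<B>: "finite \<B>" "\<B> \<subseteq> sets M"
  obtains \<phi> \<psi> where "\<phi> \<in> N \<rightarrow>\<^sub>M M" "\<psi> \<in> M \<rightarrow>\<^sub>M N" "distr N M \<phi> = M" "distr M N \<psi> = N"
    "AE y in N. \<psi> (\<phi> y) = y" "AE x in M. \<phi> (\<psi> x) = x"
    "\<And>A. A \<in> \<B> \<Longrightarrow> AE y in N. \<phi> y \<in> A \<longleftrightarrow> p y \<in> A"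
proof -
  interpret N: prob_space N by fact
  obtain b :: "'a \<Rightarrow> nat" where b [measurable]: "b \<in> M \<rightarrow>\<^sub>M count_space UNIV"
    and J: "\<And>A. A \<in> \<B> \<Longrightarrow> \<exists>J. \<forall>x. x \<in> A \<longleftrightarrow> b x \<in> J"
    using finite_family_label[OF \<B>] by blast
  \<comment> \<open>A point is the preimage of a real number under the encoding, which is
    injective.\<close>
  have sing: "{x} \<in> sets M" if "x \<in> space M" for x
  proof -
    obtain f :: "'a \<Rightarrow> real" and g where f: "f \<in> borel_measurable M" and gf: "\<And>y. y \<in> space M \<Longrightarrow> g (f y) = (y::'a)"
      using M(2) unfolding encodable_def by blast
    have "z = x" if "z \<in> space M" "f z = f x" for z
      using gf[OF that(1)] gf[OF \<open>x \<in> space M\<close>] that(2) by metis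
    then have "f -` {f x} \<inter> space M = {x}" using \<open>x \<in> space M\<close> by blast
    then show ?thesis
      using measurable_sets[OF f borel_singleton[OF sets.empty_sets, of "f x"]] by (simp only:)
  qed
  \<comment> \<open>An atom of \<open>N\<close> would be mapped by \<open>p\<close> to an atom of
    \<open>M\<close>.\<close>
  have atomless': "emeasure N {y} = 0" if y: "y \<in> space N" for y
  proof -
    have py: "p y \<in> space M" using y by (rule measurable_space[OF p])
    have "emeasure N {y} \<le> emeasure N (p -` {p y} \<inter> space N)"
      using y sing[OF py] by (intro emeasure_mono) auto
    also have "\<dots> = emeasure (distr N M p) {p y}"
      using sing[OF py] by (simp add: emeasure_distr)
    also have "\<dots> = 0" unfolding dp by (rule atomless[OF py])
    finally show ?thesis by simp
  qed
  define m where "m k = measure M {z\<in>space M. b z < k}" for k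
  obtain u v where u: "u \<in> M \<rightarrow>\<^sub>M unif" and v: "v \<in> unif \<rightarrow>\<^sub>M M" and du: "distr M unif u = unif"
    and dv: "distr unif M v = M" and vu: "AE y in M. v (u y) = y" and uv: "AE t in unif. u (v t) = t"
    and lab: "AE y in M. m (b y) < u y \<and> u y < m (Suc (b y))"
    using label_uniformize[OF M b atomless] unfolding m_def by blast
  have b': "(\<lambda>y. b (p y)) \<in> N \<rightarrow>\<^sub>M count_space UNIV" by measurable
  have m: "m k = measure N {z\<in>space N. b (p z) < k}" for k
    unfolding m_def by (subst dp[symmetric], subst measure_distr)
      (auto intro!: arg_cong[where f="measure N"] measurable_space[OF p])
  obtain u' v' where u': "u' \<in> N \<rightarrow>\<^sub>M unif" and v': "v' \<in> unif \<rightarrow>\<^sub>M N" and du': "distr N unif u' = unif"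
    and dv': "distr unif N v' = N" and vu': "AE y in N. v' (u' y) = y" and uv': "AE t in unif. u' (v' t) = t"
    and lab': "AE y in N. m (b (p y)) < u' y \<and> u' y < m (Suc (b (p y)))"
    using label_uniformize[OF N b' atomless'] unfolding m by blast
  define \<phi> where "\<phi> y = v (u' y)" for y
  define \<psi> where "\<psi> x = v' (u x)" for x
  have \<phi>: "\<phi> \<in> N \<rightarrow>\<^sub>M M" unfolding \<phi>_def using u' v by measurable
  have \<psi>: "\<psi> \<in> M \<rightarrow>\<^sub>M N" unfolding \<psi>_def using u v' by measurable
  have d\<phi>: "distr N M \<phi> = M"
    using distr_distr[OF v u'] unfolding du' dv by (simp add: \<phi>_def[abs_def] comp_def)
  have d\<psi>: "distr M N \<psi> = N"
    using distr_distr[OF v' u] unfolding du dv' by (simp add: \<psi>_def[abs_def] comp_def)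
  have uv_N: "AE y in N. u (v (u' y)) = u' y" by (rule AE_pullback[OF u' du' uv])
  have 1: "AE y in N. \<psi> (\<phi> y) = y"
    using uv_N vu' unfolding \<phi>_def \<psi>_def by eventually_elim simp
  have 2: "AE x in M. \<phi> (\<psi> x) = x"
    using AE_pullback[OF u du uv'] vu unfolding \<phi>_def \<psi>_def by eventually_elim simp
  have m_mono: "m k \<le> m l" if "k \<le> l" for k l
    unfolding m by (rule N.finite_measure_mono) (use that in auto)
  \<comment> \<open>The coordinate \<open>u' y\<close> lies strictly inside the intervals of both
    labels; by monotonicity of \<open>m\<close>, intervals of different labels have no common
    interior point.\<close>
  have "AE y in N. b (\<phi> y) = b (p y)"
    using AE_pullback[OF \<phi> d\<phi> lab] lab' uv_N
  proof eventually_elim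
    case (elim y)
    then have "m (b (\<phi> y)) < m (Suc (b (p y)))" "m (b (p y)) < m (Suc (b (\<phi> y)))"
      unfolding \<phi>_def by auto
    then have "\<not> Suc (b (p y)) \<le> b (\<phi> y)" "\<not> Suc (b (\<phi> y)) \<le> b (p y)"
      using m_mono by (meson not_less)+
    then show ?case by simp
  qed
  then have 3: "AE y in N. \<phi> y \<in> A \<longleftrightarrow> p y \<in> A" if "A \<in> \<B>" for A
  proof eventually_elim
    case (elim y)
    with J[OF that] show ?case by metis
  qed
  show ?thesis using that[OF \<phi> \<psi> d\<phi> d\<psi> 1 2 3] .
qed

section \<open>Actions and their transport\<close>

definition dis :: "'a measure \<Rightarrow> ('a \<Rightarrow> bool) \<Rightarrow> ('a \<Rightarrow> bool) \<Rightarrow> real" where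
  "dis M P Q = measure M {x\<in>space M. P x \<noteq> Q x}"

lemma dis_commute: "dis M P Q = dis M Q P"
  unfolding dis_def by (metis (no_types, lifting))

lemma dis_nonneg: "0 \<le> dis M P Q"
  unfolding dis_def by simp

lemma (in finite_measure) dis_triangle:
  assumes [measurable]: "Measurable.pred M P" "Measurable.pred M Q" "Measurable.pred M R"
  shows "dis M P R \<le> dis M P Q + dis M Q R"
proof -
  have "dis M P R \<le> measure M ({x\<in>space M. P x \<noteq> Q x} \<union> {x\<in>space M. Q x \<noteq> R x})"
    unfolding dis_def by (rule finite_measure_mono) auto
  also have "\<dots> \<le> dis M P Q + dis M Q R"
    unfolding dis_def by (rule measure_Un_le) auto
  finally show ?thesis .
qed

lemma dis_cong_AE:
  assumes [measurable]: "Measurable.pred M P" "Measurable.pred M Q" "Measurable.pred M P'" "Measurable.pred M Q'"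
  assumes "AE x in M. P x = P' x" "AE x in M. Q x = Q' x"
  shows "dis M P Q = dis M P' Q'"
  unfolding dis_def
proof (rule measure_eq_AE)
  show "AE x in M. (x \<in> {x \<in> space M. P x \<noteq> Q x}) = (x \<in> {x \<in> space M. P' x \<noteq> Q' x})"
    using assms(5,6) by eventually_elim simp
qed simp_all

lemma dis_distr:
  assumes [measurable]: "f \<in> M \<rightarrow>\<^sub>M N" and d: "distr M N f = N"
    and [measurable]: "Measurable.pred N P" "Measurable.pred N Q"
  shows "dis M (\<lambda>x. P (f x)) (\<lambda>x. Q (f x)) = dis N P Q"
proof -
  have "dis N P Q = measure (distr M N f) {x\<in>space N. P x \<noteq> Q x}"
    unfolding dis_def d ..
  also have "\<dots> = dis M (\<lambda>x. P (f x)) (\<lambda>x. Q (f x))"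
    unfolding dis_def
    by (subst measure_distr) (auto intro!: arg_cong[where f="measure M"] measurable_space[OF assms(1)])
  finally show ?thesis by simp
qed

lemma dis_mp:
  assumes "mp M f" "Measurable.pred M P" "Measurable.pred M Q"
  shows "dis M (\<lambda>x. P (f x)) (\<lambda>x. Q (f x)) = dis M P Q"
  using dis_distr[of f M M P Q] assms unfolding mp_def by simp

text \<open>The form used for auxiliary spaces such as \<open>X \<times> Z\<close> and
  \<open>X\<^sup>G\<close>: invertibility is not postulated but follows from the identity law, with
  \<open>R (- g)\<close> inverting \<open>R g\<close> modulo null sets.\<close>

definition mp_action :: "'b measure \<Rightarrow> 'g::ab_group_add set \<Rightarrow> ('g \<Rightarrow> 'b \<Rightarrow> 'b) \<Rightarrow> bool" where
  "mp_action N K R \<longleftrightarrow> (\<forall>g\<in>K. mp N (R g)) \<and> (AE y in N. R 0 y = y) \<and>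
     (\<forall>g\<in>K. \<forall>h\<in>K. AE y in N. R (g + h) y = R g (R h y))"

definition add_subgroup :: "'g::ab_group_add set \<Rightarrow> bool" where
  "add_subgroup K \<longleftrightarrow> 0 \<in> K \<and> (\<forall>g\<in>K. \<forall>h\<in>K. g + h \<in> K) \<and> (\<forall>g\<in>K. - g \<in> K)"

lemma add_subgroupD:
  assumes "add_subgroup K"
  shows "0 \<in> K" "g \<in> K \<Longrightarrow> h \<in> K \<Longrightarrow> g + h \<in> K" "g \<in> K \<Longrightarrow> - g \<in> K" "g \<in> K \<Longrightarrow> h \<in> K \<Longrightarrow> g - h \<in> K"
  using assms unfolding add_subgroup_def by (auto simp: diff_conv_add_uminus simp del: add_uminus_conv_diff)

lemma actionsD:
  assumes "S \<in> actions M K"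
  shows "g \<in> K \<Longrightarrow> S g \<in> Aut M" "g \<in> K \<Longrightarrow> mp M (S g)" "g \<in> K \<Longrightarrow> S g \<in> M \<rightarrow>\<^sub>M M"
    "g \<in> K \<Longrightarrow> distr M M (S g) = M"
    "g \<in> K \<Longrightarrow> h \<in> K \<Longrightarrow> AE x in M. S (g + h) x = S g (S h x)"
  using assms unfolding actions_def Aut_def mp_def by auto

lemma mp_AE: "mp M f \<Longrightarrow> AE x in M. P x \<Longrightarrow> AE x in M. P (f x)"
  unfolding mp_def using AE_pullback by blast

text \<open>An idempotent invertible map is the identity.\<close>
lemma actions_zero:
  assumes "S \<in> actions M K" "0 \<in> K"
  shows "AE x in M. S 0 x = x"
proof -
  obtain g where g: "mp M g" "AE x in M. g (S 0 x) = x" "AE x in M. S 0 (g x) = x"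
    using actionsD(1)[OF assms] unfolding Aut_def by blast
  have "AE x in M. S 0 x = S 0 (S 0 x)"
    using actionsD(5)[OF assms(1) assms(2) assms(2)] by simp
  then have "AE x in M. S 0 (g x) = S 0 (S 0 (g x))" by (rule mp_AE[OF g(1)])
  with g(3) show ?thesis by eventually_elim simp
qed

lemma actions_mp_action:
  assumes "S \<in> actions M K" "0 \<in> K"
  shows "mp_action M K S"
  using actions_zero[OF assms] actionsD(2,5)[OF assms(1)] unfolding mp_action_def by blast

lemma mp_action_actions:
  assumes S: "mp_action M K S" and K: "add_subgroup K"
  shows "restrict S K \<in> actions M K"
proof -
  have "S g \<in> Aut M" if g: "g \<in> K" for g
    unfolding Aut_def
  proof (intro CollectI conjI exI[of _ "S (- g)"])
    note ng = add_subgroupD(3)[OF K g]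
    show "mp M (S g)" "mp M (S (- g))" using S g ng unfolding mp_action_def by auto
    have Z: "AE x in M. S 0 x = x" using S unfolding mp_action_def by auto
    have "AE x in M. S (- g + g) x = S (- g) (S g x)" "AE x in M. S (g + - g) x = S g (S (- g) x)"
      using S g ng unfolding mp_action_def by blast+
    then have "AE x in M. S 0 x = S (- g) (S g x)" "AE x in M. S 0 x = S g (S (- g) x)"
      by simp_all
    with Z show "AE x in M. S (- g) (S g x) = x" "AE x in M. S g (S (- g) x) = x"
      by (auto elim: eventually_elim2)
  qed
  moreover have "AE x in M. S (g + h) x = S g (S h x)" if "g \<in> K" "h \<in> K" for g h
    using S that unfolding mp_action_def by auto
  ultimately show ?thesis
    unfolding actions_def using add_subgroupD(2)[OF K] by (auto simp: PiE_def)
qed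

lemma actions_restrict:
  assumes "S \<in> actions M K" "H \<subseteq> K" "add_subgroup H"
  shows "restrict S H \<in> actions M H"
  using assms(1,2) add_subgroupD(2)[OF assms(3)] unfolding actions_def
  by (auto simp: PiE_def subset_iff)

text \<open>The action is conjugated by the isomorphism \<open>\<phi>\<close> of
  \<open>relabel_iso\<close>. Since \<open>\<phi>\<close> and \<open>p\<close> agree on the sets of
  \<open>\<B>\<close>, all distances between these sets and their preimages can be computed on
  \<open>N\<close> with \<open>p\<close>.\<close>

lemma transfer_action:
  fixes N :: "'b measure" and M :: "'a measure"
  assumes N: "prob_space N" "encodable N" and M: "prob_space M" "encodable M"
    and atomless: "\<And>x. x \<in> space M \<Longrightarrow> emeasure M {x} = 0"
    and p [measurable]: "p \<in> N \<rightarrow>\<^sub>M M" and dp: "distr N M p = M"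
    and \<B>: "finite \<B>" "\<B> \<subseteq> sets M"
    and K: "add_subgroup K" and R: "mp_action N K R"
  shows "\<exists>S\<in>actions M K. \<forall>g\<in>K. \<forall>A\<in>\<B>. \<forall>C\<in>\<B>.
    dis M (\<lambda>x. S g x \<in> A) (\<lambda>x. x \<in> C) = dis N (\<lambda>y. p (R g y) \<in> A) (\<lambda>y. p y \<in> C)"
proof -
  obtain \<phi> \<psi> where \<phi> [measurable]: "\<phi> \<in> N \<rightarrow>\<^sub>M M" and \<psi> [measurable]: "\<psi> \<in> M \<rightarrow>\<^sub>M N"
    and d\<phi>: "distr N M \<phi> = M" and d\<psi>: "distr M N \<psi> = N"
    and \<psi>\<phi>: "AE y in N. \<psi> (\<phi> y) = y" and \<phi>\<psi>: "AE x in M. \<phi> (\<psi> x) = x"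
    and lab: "\<And>A. A \<in> \<B> \<Longrightarrow> AE y in N. \<phi> y \<in> A \<longleftrightarrow> p y \<in> A"
    using relabel_iso[OF N M atomless p dp \<B>] by blast
  have Rmp: "mp N (R g)" and Rm: "R g \<in> N \<rightarrow>\<^sub>M N" and dR: "distr N N (R g) = N" if "g \<in> K" for g
    using R that unfolding mp_action_def mp_def by auto
  define S where "S g x = \<phi> (R g (\<psi> x))" for g x
  have "mp_action M K S"
    unfolding mp_action_def
  proof (intro conjI ballI)
    fix g assume g: "g \<in> K"
    note [measurable] = Rm[OF g]
    have "distr M M (S g) = distr (distr (distr M N \<psi>) N (R g)) M \<phi>"
      unfolding S_def[abs_def] by (subst distr_distr, simp, simp)+ (simp add: comp_def)
    then show "mp M (S g)"
      unfolding mp_def d\<psi> dR[OF g] d\<phi> unfolding S_def by simp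
  next
    have "AE x in M. R 0 (\<psi> x) = \<psi> x"
      by (rule AE_pullback[OF \<psi> d\<psi>]) (use R in \<open>simp add: mp_action_def\<close>)
    with \<phi>\<psi> show "AE x in M. S 0 x = x" unfolding S_def by eventually_elim simp
  next
    fix g h assume g: "g \<in> K" and h: "h \<in> K"
    have "AE y in N. R (g + h) y = R g (R h y)"
      using R g h unfolding mp_action_def by auto
    moreover have "AE y in N. \<psi> (\<phi> (R h y)) = R h y" by (rule mp_AE[OF Rmp[OF h] \<psi>\<phi>])
    ultimately have "AE y in N. \<phi> (R (g + h) y) = \<phi> (R g (\<psi> (\<phi> (R h y))))"
      by eventually_elim simp
    then show "AE x in M. S (g + h) x = S g (S h x)"
      unfolding S_def by (rule AE_pullback[OF \<psi> d\<psi>])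
  qed
  then have "restrict S K \<in> actions M K" by (rule mp_action_actions[OF _ K])
  moreover have "dis M (\<lambda>x. restrict S K g x \<in> A) (\<lambda>x. x \<in> C) = dis N (\<lambda>y. p (R g y) \<in> A) (\<lambda>y. p y \<in> C)"
    if g: "g \<in> K" and A: "A \<in> \<B>" and C: "C \<in> \<B>" for g A C
  proof -
    note [measurable] = Rm[OF g]
    have [measurable]: "A \<in> sets M" "C \<in> sets M" using A C \<B> by auto
    have "dis M (\<lambda>x. restrict S K g x \<in> A) (\<lambda>x. x \<in> C) = dis M (\<lambda>x. \<phi> (R g (\<psi> x)) \<in> A) (\<lambda>x. x \<in> C)"
      using g by (simp add: S_def)
    also have "\<dots> = dis N (\<lambda>y. \<phi> (R g (\<psi> (\<phi> y))) \<in> A) (\<lambda>y. \<phi> y \<in> C)"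
      by (rule dis_distr[OF \<phi> d\<phi>, symmetric]) measurable
    also have "\<dots> = dis N (\<lambda>y. p (R g y) \<in> A) (\<lambda>y. p y \<in> C)"
    proof (rule dis_cong_AE)
      show "AE y in N. (\<phi> (R g (\<psi> (\<phi> y))) \<in> A) = (p (R g y) \<in> A)"
        using mp_AE[OF Rmp[OF g] lab[OF A]] \<psi>\<phi> by eventually_elim simp
      show "AE y in N. (\<phi> y \<in> C) = (p y \<in> C)" by (rule lab[OF C])
    qed measurable
    finally show ?thesis .
  qed
  ultimately show ?thesis by blast
qed

section \<open>Locally dense extensions\<close>

lemma std_atomless_probD:
  fixes M :: "'a::polish_space measure"
  assumes "std_atomless_prob M"
  shows "prob_space M" "sets M = sets borel" "space M = UNIV" "encodable M" "emeasure M {x} = 0"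
  using assms unfolding std_atomless_prob_def
  by (auto intro: encodable_polish dest: sets_eq_imp_space_eq)

lemma encodable_cong:
  assumes "sets M = sets N"
  shows "encodable M \<longleftrightarrow> encodable N"
  unfolding encodable_def measurable_cong_sets[OF assms refl] measurable_cong_sets[OF refl assms]
    sets_eq_imp_space_eq[OF assms] ..

text \<open>The data \<open>E\<close>, \<open>\<A>\<close>, \<open>e\<close> stand for a basic neighbourhood in the space of \<open>K\<close>-actions. Preimages replace
  images, which amounts to passing from \<open>g\<close> to \<open>- g\<close>.\<close>
abbreviation test :: "'a measure \<Rightarrow> 'g set \<Rightarrow> 'g set \<Rightarrow> 'a set set \<Rightarrow> real \<Rightarrow> bool" where
  "test M K E \<A> e \<equiv> finite E \<and> E \<subseteq> K \<and> finite \<A> \<and> \<A> \<subseteq> sets M \<and> 0 < e"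

definition close :: "'a measure \<Rightarrow> 'g set \<Rightarrow> 'a set set \<Rightarrow> real \<Rightarrow> ('g \<Rightarrow> 'a \<Rightarrow> 'a) \<Rightarrow> ('g \<Rightarrow> 'a \<Rightarrow> 'a) \<Rightarrow> bool" where
  "close M E \<A> e S T \<longleftrightarrow> (\<forall>g\<in>E. \<forall>A\<in>\<A>. dis M (\<lambda>x. S g x \<in> A) (\<lambda>x. T g x \<in> A) < e)"

text \<open>\<open>S\<close> lies in the closure of the restrictions to \<open>K\<close> of those
  \<open>L\<close>-actions that are within the basic neighbourhood \<open>E\<close>,
  \<open>\<A>\<close>, \<open>e\<close> of \<open>T\<close>.\<close>

definition approx_extends where
  "approx_extends M T K L E \<A> e S \<longleftrightarrow> (\<forall>E' \<A>' e'. test M K E' \<A>' e' \<longrightarrow>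
     (\<exists>R\<in>actions M L. close M E \<A> e R T \<and> close M E' \<A>' e' R S))"

text \<open>Local density at \<open>T\<close> of the restriction map from \<open>L\<close>-actions
  to \<open>K\<close>-actions, spelled out on basic neighbourhoods. \<open>T\<close> is kept as one
  function on the whole group, so that chains of subgroups can be composed.\<close>

definition locally_dense_extension ::
    "'a measure \<Rightarrow> ('g::ab_group_add \<Rightarrow> 'a \<Rightarrow> 'a) \<Rightarrow> 'g set \<Rightarrow> 'g set \<Rightarrow> bool" where
  "locally_dense_extension M T K L \<longleftrightarrow> (\<forall>E \<A> e. test M L E \<A> e \<longrightarrow>
     (\<exists>E' \<A>' e'. test M K E' \<A>' e' \<and>
       (\<forall>S\<in>actions M K. close M E' \<A>' e' S T \<longrightarrow> approx_extends M T K L E \<A> e S)))"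

lemma approx_extendsI:
  assumes "\<And>E' \<A>' e'. test M K E' \<A>' e' \<Longrightarrow>
    \<exists>R\<in>actions M L. close M E \<A> e R T \<and> close M E' \<A>' e' R S"
  shows "approx_extends M T K L E \<A> e S"
  unfolding approx_extends_def by (intro allI impI) (rule assms)

lemma approx_extendsE:
  assumes "approx_extends M T K L E \<A> e S" "test M K E' \<A>' e'"
  obtains R where "R \<in> actions M L" "close M E \<A> e R T" "close M E' \<A>' e' R S"
proof -
  have "\<exists>R\<in>actions M L. close M E \<A> e R T \<and> close M E' \<A>' e' R S"
    using assms(1)[unfolded approx_extends_def, rule_format] assms(2) by simp
  then show ?thesis using that by blast
qed

lemma locally_dense_extensionI:
  assumes "\<And>E \<A> e. test M L E \<A> e \<Longrightarrow> \<exists>E' \<A>' e'. test M K E' \<A>' e' \<and>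
       (\<forall>S\<in>actions M K. close M E' \<A>' e' S T \<longrightarrow> approx_extends M T K L E \<A> e S)"
  shows "locally_dense_extension M T K L"
  unfolding locally_dense_extension_def by (intro allI impI) (rule assms)

lemma locally_dense_extensionE:
  assumes "locally_dense_extension M T K L" "test M L E \<A> e"
  obtains E' \<A>' e' where "test M K E' \<A>' e'"
    "\<And>S. S \<in> actions M K \<Longrightarrow> close M E' \<A>' e' S T \<Longrightarrow> approx_extends M T K L E \<A> e S"
proof -
  have "\<exists>E' \<A>' e'. test M K E' \<A>' e' \<and>
       (\<forall>S\<in>actions M K. close M E' \<A>' e' S T \<longrightarrow> approx_extends M T K L E \<A> e S)"
    using assms(1)[unfolded locally_dense_extension_def, rule_format] assms(2) by simp
  then show ?thesis using that by blast
qed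

lemma close_refl: "0 < e \<Longrightarrow> close M E \<A> e S S"
  unfolding close_def dis_def by simp

lemma close_mono: "close M E \<A> e S T \<Longrightarrow> E' \<subseteq> E \<Longrightarrow> \<A>' \<subseteq> \<A> \<Longrightarrow> e \<le> e' \<Longrightarrow> close M E' \<A>' e' S T"
  unfolding close_def by fastforce

lemma close_trans:
  assumes "finite_measure M" "\<A> \<subseteq> sets M"
    and S: "\<And>g. g \<in> E \<Longrightarrow> S g \<in> M \<rightarrow>\<^sub>M M" and T: "\<And>g. g \<in> E \<Longrightarrow> T g \<in> M \<rightarrow>\<^sub>M M"
    and R: "\<And>g. g \<in> E \<Longrightarrow> R g \<in> M \<rightarrow>\<^sub>M M"
    and "close M E \<A> e1 R S" "close M E \<A> e2 S T"
  shows "close M E \<A> (e1 + e2) R T"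
  unfolding close_def
proof (intro ballI)
  interpret finite_measure M by fact
  fix g A assume g: "g \<in> E" and A: "A \<in> \<A>"
  have [measurable]: "A \<in> sets M" using A assms(2) by auto
  note [measurable] = S[OF g] T[OF g] R[OF g]
  have "dis M (\<lambda>x. R g x \<in> A) (\<lambda>x. T g x \<in> A)
      \<le> dis M (\<lambda>x. R g x \<in> A) (\<lambda>x. S g x \<in> A) + dis M (\<lambda>x. S g x \<in> A) (\<lambda>x. T g x \<in> A)"
    by (rule dis_triangle) measurable
  then show "dis M (\<lambda>x. R g x \<in> A) (\<lambda>x. T g x \<in> A) < e1 + e2"
    using assms(6,7) g A unfolding close_def by fastforce
qed

lemma locally_dense_extension_refl: "locally_dense_extension M T K K"
proof (rule locally_dense_extensionI)
  fix E \<A> e assume t: "test M K E \<A> e"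
  have "approx_extends M T K K E \<A> e S" if "S \<in> actions M K" "close M E \<A> e S T" for S
    by (rule approx_extendsI) (use that close_refl in blast)
  with t show "\<exists>E' \<A>' e'. test M K E' \<A>' e' \<and>
       (\<forall>S\<in>actions M K. close M E' \<A>' e' S T \<longrightarrow> approx_extends M T K K E \<A> e S)"
    by blast
qed

text \<open>The first extension is made as close to \<open>T\<close> as the second one demands of
  its starting point; the two errors relative to \<open>S\<close> add up.\<close>

lemma locally_dense_extension_trans:
  assumes M: "finite_measure M" and KL: "K \<subseteq> L" "L \<subseteq> L'"
    and 1: "locally_dense_extension M T K L" and 2: "locally_dense_extension M T L L'"
  shows "locally_dense_extension M T K L'"
proof (rule locally_dense_extensionI)
  fix E \<A> e assume "test M L' E \<A> e"
  from locally_dense_extensionE[OF 2 this] obtain E1 \<A>1 e1 where t1: "test M L E1 \<A>1 e1" and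
    ext1: "\<And>S. S \<in> actions M L \<Longrightarrow> close M E1 \<A>1 e1 S T \<Longrightarrow> approx_extends M T L L' E \<A> e S"
    by blast
  from locally_dense_extensionE[OF 1 t1] obtain E0 \<A>0 e0 where t0: "test M K E0 \<A>0 e0" and
    ext0: "\<And>S. S \<in> actions M K \<Longrightarrow> close M E0 \<A>0 e0 S T \<Longrightarrow> approx_extends M T K L E1 \<A>1 e1 S"
    by blast
  have "approx_extends M T K L' E \<A> e S" if S: "S \<in> actions M K" "close M E0 \<A>0 e0 S T" for S
  proof (rule approx_extendsI)
    fix E2 \<A>2 e2 assume t2: "test M K E2 \<A>2 e2"
    then have t2': "test M K E2 \<A>2 (e2 / 2)" "test M L E2 \<A>2 (e2 / 2)" using KL by auto
    from approx_extendsE[OF ext0[OF S] t2'(1)]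
    obtain R where R: "R \<in> actions M L" "close M E1 \<A>1 e1 R T" "close M E2 \<A>2 (e2/2) R S" .
    from approx_extendsE[OF ext1[OF R(1,2)] t2'(2)]
    obtain R' where R': "R' \<in> actions M L'" "close M E \<A> e R' T" "close M E2 \<A>2 (e2/2) R' R" .
    have "close M E2 \<A>2 (e2/2 + e2/2) R' S"
    proof (rule close_trans[OF M _ _ _ _ R'(3) R(3)])
      fix g assume "g \<in> E2"
      then have "g \<in> K" "g \<in> L" "g \<in> L'" using t2 KL by auto
      then show "S g \<in> M \<rightarrow>\<^sub>M M" "R g \<in> M \<rightarrow>\<^sub>M M" "R' g \<in> M \<rightarrow>\<^sub>M M"
        using actionsD(3)[OF R(1)] actionsD(3)[OF R'(1)] actionsD(3)[OF S(1)] by blast+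
    qed (use t2 in blast)
    then have "close M E2 \<A>2 e2 R' S" by simp
    with R'(1,2) show "\<exists>R\<in>actions M L'. close M E \<A> e R T \<and> close M E2 \<A>2 e2 R S" by blast
  qed
  with t0 show "\<exists>E' \<A>' e'. test M K E' \<A>' e' \<and>
       (\<forall>S\<in>actions M K. close M E' \<A>' e' S T \<longrightarrow> approx_extends M T K L' E \<A> e S)"
    by blast
qed

section \<open>Displacement of sets and density of a subgroup\<close>

definition displacement :: "'a measure \<Rightarrow> ('a \<Rightarrow> 'a) \<Rightarrow> 'a set \<Rightarrow> real" where
  "displacement M f A = dis M (\<lambda>x. f x \<in> A) (\<lambda>x. x \<in> A)"

text \<open>The action law rewrites \<open>T g\<close> as \<open>T (g - h)\<close> after
  \<open>T h\<close>, and \<open>T h\<close> preserves the measure.\<close>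

lemma dis_action:
  assumes T: "mp_action M UNIV T" and [measurable]: "A \<in> sets M"
  shows "dis M (\<lambda>x. T g x \<in> A) (\<lambda>x. T h x \<in> A) = displacement M (T (g - h)) A"
proof -
  have mp: "mp M (T g)" for g using T unfolding mp_action_def by auto
  then have [measurable]: "T g \<in> M \<rightarrow>\<^sub>M M" for g unfolding mp_def by auto
  have "AE x in M. T (g - h + h) x = T (g - h) (T h x)"
    using T unfolding mp_action_def by blast
  then have "AE x in M. (T g x \<in> A) = (T (g - h) (T h x) \<in> A)"
    by eventually_elim simp
  then have "dis M (\<lambda>x. T g x \<in> A) (\<lambda>x. T h x \<in> A) = dis M (\<lambda>x. T (g - h) (T h x) \<in> A) (\<lambda>x. T h x \<in> A)"
    by (intro dis_cong_AE) auto
  also have "\<dots> = displacement M (T (g - h)) A"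
    unfolding displacement_def by (rule dis_mp[OF mp]) measurable
  finally show ?thesis .
qed

text \<open>For a fixed set \<open>A\<close>, the displacement is a pseudo-length on the group, by
  translation invariance and the triangle inequality for \<open>dis\<close>.\<close>

lemma displacement_action:
  assumes T: "mp_action M UNIV T" and M: "finite_measure M" and A [measurable]: "A \<in> sets M"
  shows displacement_zero: "displacement M (T 0) A = 0"
    and displacement_minus: "displacement M (T (- g)) A = displacement M (T g) A"
    and displacement_add: "displacement M (T (g + h)) A \<le> displacement M (T g) A + displacement M (T h) A"
proof -
  interpret finite_measure M by fact
  have [measurable]: "T g \<in> M \<rightarrow>\<^sub>M M" for g using T unfolding mp_action_def mp_def by auto
  have "dis M (\<lambda>x. T 0 x \<in> A) (\<lambda>x. T 0 x \<in> A) = 0" by (simp add: dis_def)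
  then show "displacement M (T 0) A = 0" unfolding dis_action[OF T A] by simp
  have "dis M (\<lambda>x. T 0 x \<in> A) (\<lambda>x. T g x \<in> A) = dis M (\<lambda>x. T g x \<in> A) (\<lambda>x. T 0 x \<in> A)"
    by (rule dis_commute)
  then show "displacement M (T (- g)) A = displacement M (T g) A"
    unfolding dis_action[OF T A] by simp
  have "displacement M (T (g + h)) A \<le> dis M (\<lambda>x. T (g + h) x \<in> A) (\<lambda>x. T h x \<in> A) + displacement M (T h) A"
    unfolding displacement_def by (rule dis_triangle) measurable
  then show "displacement M (T (g + h)) A \<le> displacement M (T g) A + displacement M (T h) A"
    unfolding dis_action[OF T A] by simp
qed

primrec nmul :: "nat \<Rightarrow> 'g::ab_group_add \<Rightarrow> 'g" where
  "nmul 0 g = 0"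
| "nmul (Suc n) g = g + nmul n g"

lemma nmul_add: "nmul (m + n) g = nmul m g + nmul n g"
  by (induction m) (auto simp: add.assoc)

lemma nmul_diff: "nmul n (g - h) = nmul n g - nmul n h"
  by (induction n) (auto simp: algebra_simps)

lemma nmul_closed: "add_subgroup K \<Longrightarrow> g \<in> K \<Longrightarrow> nmul n g \<in> K"
  by (induction n) (auto simp: add_subgroupD)

lemma nmul_mult: "nmul (m * n) g = nmul m (nmul n g)"
  by (induction m) (auto simp: nmul_add)

lemma displacement_nmul:
  assumes "mp_action M UNIV T" "finite_measure M" "A \<in> sets M"
  shows "displacement M (T (nmul n g)) A \<le> n * displacement M (T g) A"
proof (induction n)
  case 0
  then show ?case using displacement_zero[OF assms] by simp
next
  case (Suc n)
  then show ?case using displacement_add[OF assms, of g "nmul n g"] by (simp add: algebra_simps)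
qed

text \<open>Every coset of \<open>K\<close> contains elements acting almost trivially on given sets.
  By \<open>dis_action\<close> this is density of the maps \<open>T h\<close>,
  \<open>h \<in> K\<close>, among all \<open>T g\<close>.\<close>

definition dense_in_orbit :: "'a measure \<Rightarrow> ('g::ab_group_add \<Rightarrow> 'a \<Rightarrow> 'a) \<Rightarrow> 'g set \<Rightarrow> bool" where
  "dense_in_orbit M T K \<longleftrightarrow> (\<forall>g \<A> e. finite \<A> \<and> \<A> \<subseteq> sets M \<and> 0 < e \<longrightarrow>
     (\<exists>h\<in>K. \<forall>A\<in>\<A>. displacement M (T (g - h)) A < e))"

text \<open>The subgroup generated by \<open>K\<close> and \<open>g\<close>; the pair
  \<open>a\<close>, \<open>b\<close> of naturals stands for the integer coefficient
  \<open>a - b\<close>.\<close>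

definition adjoin :: "'g::ab_group_add set \<Rightarrow> 'g \<Rightarrow> 'g set" where
  "adjoin K g = {k + nmul a g - nmul b g | k a b. k \<in> K}"

lemma adjoinI: "k \<in> K \<Longrightarrow> k + nmul a g - nmul b g \<in> adjoin K g"
  unfolding adjoin_def by blast

lemma adjoin:
  assumes K: "add_subgroup K"
  shows add_subgroup_adjoin: "add_subgroup (adjoin K g)"
    and adjoin_supset: "K \<subseteq> adjoin K g"
    and mem_adjoin: "g \<in> adjoin K g"
proof -
  show sup: "K \<subseteq> adjoin K g"
    using adjoinI[of _ K 0 g 0] by auto
  show "g \<in> adjoin K g"
    using adjoinI[OF add_subgroupD(1)[OF K], of 1 g 0] by simp
  show "add_subgroup (adjoin K g)"
    unfolding add_subgroup_def
  proof (intro conjI ballI)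
    show "0 \<in> adjoin K g" using sup add_subgroupD(1)[OF K] by blast
  next
    fix x y assume "x \<in> adjoin K g" "y \<in> adjoin K g"
    then obtain k a b l c d where "k \<in> K" "l \<in> K"
      and xy: "x = k + nmul a g - nmul b g" "y = l + nmul c g - nmul d g"
      unfolding adjoin_def by blast
    moreover have "x + y = (k + l) + nmul (a + c) g - nmul (b + d) g"
      unfolding xy nmul_add by (simp add: algebra_simps)
    ultimately show "x + y \<in> adjoin K g"
      using adjoinI add_subgroupD(2)[OF K] by metis
  next
    fix x assume "x \<in> adjoin K g"
    then obtain k a b where "k \<in> K" and x: "x = k + nmul a g - nmul b g"
      unfolding adjoin_def by blast
    moreover have "- x = - k + nmul b g - nmul a g"
      unfolding x by (simp add: algebra_simps)
    ultimately show "- x \<in> adjoin K g"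
      using adjoinI add_subgroupD(3)[OF K] by metis
  qed
qed

text \<open>If \<open>g\<close> is free over \<open>K\<close>, then replacing \<open>g\<close> by a nearby \<open>h \<in> K\<close> retracts \<open>adjoin K g\<close> onto \<open>K\<close>,
  and an action of \<open>K\<close> is extended by precomposing with the retraction.\<close>
lemma extension_free:
  fixes T :: "'g::ab_group_add \<Rightarrow> 'a \<Rightarrow> 'a"
  assumes M: "finite_measure M" and T: "mp_action M UNIV T" and K: "add_subgroup K"
    and dense: "dense_in_orbit M T K"
    and free: "\<And>n. 0 < n \<Longrightarrow> nmul n g \<notin> K"
  shows "locally_dense_extension M T K (adjoin K g)"
proof (rule locally_dense_extensionI)
  fix E \<A> e assume t: "test M (adjoin K g) E \<A> e"
  interpret finite_measure M by fact
  have Tm: "T g \<in> M \<rightarrow>\<^sub>M M" for g using T unfolding mp_action_def mp_def by auto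
  have "\<forall>x\<in>E. \<exists>k a b. k \<in> K \<and> x = k + nmul a g - nmul b g"
    using t unfolding adjoin_def by blast
  then obtain k a b where kab: "\<And>x. x \<in> E \<Longrightarrow> k x \<in> K \<and> x = k x + nmul (a x) g - nmul (b x) g"
    by metis
  define L where "L = (\<Sum>x\<in>E. a x + b x)"
  have L: "a x + b x \<le> L" if "x \<in> E" for x
    unfolding L_def using t that by (intro member_le_sum) auto
  \<comment> \<open>Replacing \<open>g\<close> by \<open>h\<close> moves an element of
    \<open>E\<close> by at most \<open>L\<close> displacements of \<open>g - h\<close>, which this
    tolerance keeps below \<open>e / 2\<close>. The \<open>+ 1\<close> gives strictness and covers
    \<open>L = 0\<close>.\<close>
  have "0 < e / (2 * (real L + 1))" using t by simp
  then obtain h where h: "h \<in> K" and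
    h_close: "\<And>A. A \<in> \<A> \<Longrightarrow> displacement M (T (g - h)) A < e / (2 * (real L + 1))"
    using dense t unfolding dense_in_orbit_def by meson
  define rel where "rel x y \<longleftrightarrow> (\<exists>k\<in>K. \<exists>a b. x = k + nmul a g - nmul b g \<and> y = k + nmul a h - nmul b h)"
    for x y
  \<comment> \<open>Freeness determines the coefficient difference of an element, hence also its
    part in \<open>K\<close>. This makes the relation \<open>rel\<close>, the graph of the
    retraction, single-valued.\<close>
  have inj: "nmul m g - nmul n g \<in> K \<Longrightarrow> m = n" for m n
  proof (rule ccontr)
    assume d: "nmul m g - nmul n g \<in> K" and "m \<noteq> n"
    consider "m < n" | "n < m" using \<open>m \<noteq> n\<close> by linarith
    then show False
    proof cases
      case 1
      then have "nmul n g = nmul (n - m) g + nmul m g" by (simp add: nmul_add[symmetric])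
      then have "nmul (n - m) g = - (nmul m g - nmul n g)" by simp
      then show False using free[of "n - m"] 1 add_subgroupD(3)[OF K d] by simp
    next
      case 2
      then have "nmul m g = nmul (m - n) g + nmul n g" by (simp add: nmul_add[symmetric])
      then have "nmul (m - n) g = nmul m g - nmul n g" by simp
      then show False using free[of "m - n"] 2 d by simp
    qed
  qed
  have rel_unique: "y = y'" if "rel x y" "rel x y'" for x y y'
  proof -
    obtain k a b where 1: "k \<in> K" "x = k + nmul a g - nmul b g" "y = k + nmul a h - nmul b h"
      using \<open>rel x y\<close> unfolding rel_def by blast
    obtain k' a' b' where 2: "k' \<in> K" "x = k' + nmul a' g - nmul b' g" "y' = k' + nmul a' h - nmul b' h"
      using \<open>rel x y'\<close> unfolding rel_def by blast
    have *: "nmul (a + b') g - nmul (a' + b) g = k' - k"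
      using 1(2) 2(2) by (simp add: nmul_add algebra_simps)
    then have eq: "a + b' = a' + b"
      using inj add_subgroupD(4)[OF K 2(1) 1(1)] by metis
    with * have "k' = k" by simp
    moreover have "nmul a h + nmul b' h = nmul a' h + nmul b h"
      unfolding nmul_add[symmetric] eq ..
    ultimately show "y = y'" unfolding 1(3) 2(3) by (simp add: algebra_simps)
  qed
  define \<rho> where "\<rho> x = (SOME y. rel x y)" for x
  have \<rho>: "\<rho> x = y" if "rel x y" for x y
    unfolding \<rho>_def using rel_unique[OF _ that] that by (rule some_equality[rotated])
  have rel_\<rho>: "rel x (\<rho> x)" if "x \<in> adjoin K g" for x
  proof -
    have "\<exists>y. rel x y" using that unfolding rel_def adjoin_def by blast
    then show ?thesis unfolding \<rho>_def by (rule someI_ex)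
  qed
  have rel_add: "rel (x + x') (y + y')" if "rel x y" "rel x' y'" for x x' y y'
  proof -
    obtain k a b where 1: "k \<in> K" "x = k + nmul a g - nmul b g" "y = k + nmul a h - nmul b h"
      using \<open>rel x y\<close> unfolding rel_def by blast
    obtain k' a' b' where 2: "k' \<in> K" "x' = k' + nmul a' g - nmul b' g" "y' = k' + nmul a' h - nmul b' h"
      using \<open>rel x' y'\<close> unfolding rel_def by blast
    have "x + x' = (k + k') + nmul (a + a') g - nmul (b + b') g"
      unfolding 1(2) 2(2) nmul_add by (simp add: algebra_simps)
    moreover have "y + y' = (k + k') + nmul (a + a') h - nmul (b + b') h"
      unfolding 1(3) 2(3) nmul_add by (simp add: algebra_simps)
    ultimately show ?thesis
      unfolding rel_def using add_subgroupD(2)[OF K 1(1) 2(1)] by blast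
  qed
  have \<rho>_K: "\<rho> x = x" if "x \<in> K" for x
  proof (rule \<rho>)
    have "x = x + nmul 0 g - nmul 0 g" "x = x + nmul 0 h - nmul 0 h" by simp_all
    with that show "rel x x" unfolding rel_def by blast
  qed
  have \<rho>_in: "\<rho> x \<in> K" if x: "x \<in> adjoin K g" for x
  proof -
    obtain k a b where "k \<in> K" "\<rho> x = k + nmul a h - nmul b h"
      using rel_\<rho>[OF x] unfolding rel_def by blast
    then show ?thesis using h K by (simp add: add_subgroupD nmul_closed)
  qed
  have \<rho>_close: "dis M (\<lambda>z. T (\<rho> x) z \<in> A) (\<lambda>z. T x z \<in> A) < e / 2" if x: "x \<in> E" and A: "A \<in> \<A>" for x A
  proof -
    have A': "A \<in> sets M" using A t by auto
    note D = displacement_add[OF T M A'] displacement_minus[OF T M A'] displacement_nmul[OF T M A']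
    have "rel x (k x + nmul (a x) h - nmul (b x) h)"
      using kab[OF x] unfolding rel_def by blast
    \<comment> \<open>The parts in \<open>K\<close> cancel, so only multiples of
      \<open>g - h\<close> remain.\<close>
    then have "\<rho> x - x = (k x + nmul (a x) h - nmul (b x) h) - (k x + nmul (a x) g - nmul (b x) g)"
      using kab[OF x] \<rho> by metis
    also have "\<dots> = - (nmul (a x) (g - h) - nmul (b x) (g - h))"
      unfolding nmul_diff by (simp add: algebra_simps)
    finally have "dis M (\<lambda>z. T (\<rho> x) z \<in> A) (\<lambda>z. T x z \<in> A)
        = displacement M (T (nmul (a x) (g - h) + - nmul (b x) (g - h))) A"
      by (simp only: dis_action[OF T A'] D(2)) simp
    also have "\<dots> \<le> displacement M (T (nmul (a x) (g - h))) A + displacement M (T (nmul (b x) (g - h))) A"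
      using D(1) D(2) by metis
    also have "\<dots> \<le> real (a x) * displacement M (T (g - h)) A + real (b x) * displacement M (T (g - h)) A"
      by (intro add_mono D(3))
    also have "\<dots> = real (a x + b x) * displacement M (T (g - h)) A"
      by (simp add: algebra_simps)
    also have "\<dots> \<le> real L * (e / (2 * (real L + 1)))"
      using L[OF x] h_close[OF A] dis_nonneg unfolding displacement_def
      by (intro mult_mono) (auto intro: less_imp_le)
    also have "\<dots> < e / 2"
      using t by (simp add: field_simps)
    finally show ?thesis .
  qed
  have ext: "approx_extends M T K (adjoin K g) E \<A> e S"
    if S: "S \<in> actions M K" "close M (\<rho> ` E) \<A> (e / 2) S T" for S
  proof (rule approx_extendsI)
    fix E2 \<A>2 e2 assume t2: "test M K E2 \<A>2 e2"
    let ?R = "\<lambda>x. S (\<rho> x)"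
    note S_act = actions_mp_action[OF S(1) add_subgroupD(1)[OF K]]
    have "mp_action M (adjoin K g) ?R"
      unfolding mp_action_def
    proof (intro conjI ballI)
      show "AE y in M. S (\<rho> 0) y = y"
        using S_act \<rho>_K[OF add_subgroupD(1)[OF K]] unfolding mp_action_def by simp
    next
      fix x assume "x \<in> adjoin K g"
      then show "mp M (S (\<rho> x))" using S_act \<rho>_in unfolding mp_action_def by blast
    next
      fix x y assume x: "x \<in> adjoin K g" and y: "y \<in> adjoin K g"
      have "\<rho> (x + y) = \<rho> x + \<rho> y" by (intro \<rho> rel_add rel_\<rho> x y)
      then show "AE z in M. S (\<rho> (x + y)) z = S (\<rho> x) (S (\<rho> y) z)"
        using S_act \<rho>_in[OF x] \<rho>_in[OF y] unfolding mp_action_def by simp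
    qed
    then have "restrict ?R (adjoin K g) \<in> actions M (adjoin K g)"
      by (rule mp_action_actions[OF _ add_subgroup_adjoin[OF K]])
    \<comment> \<open>The intermediate point is \<open>T \<circ> \<rho>\<close>: \<open>S\<close> is
      near \<open>T\<close> on the image of \<open>E\<close> under \<open>\<rho>\<close>, and
      \<open>T \<circ> \<rho>\<close> is near \<open>T\<close> on \<open>E\<close> by the choice of
      \<open>h\<close>.\<close>
    moreover have "close M E \<A> (e / 2 + e / 2) (restrict ?R (adjoin K g)) T"
    proof (rule close_trans[OF M, where S="\<lambda>x. T (\<rho> x)"])
      show "close M E \<A> (e / 2) (restrict ?R (adjoin K g)) (\<lambda>x. T (\<rho> x))"
        using S(2) t unfolding close_def by (auto simp: subset_iff)
      show "close M E \<A> (e / 2) (\<lambda>x. T (\<rho> x)) T"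
        using \<rho>_close unfolding close_def by blast
      show "restrict ?R (adjoin K g) x \<in> M \<rightarrow>\<^sub>M M" if "x \<in> E" for x
        using that t \<rho>_in actionsD(3)[OF S(1)] by auto
    qed (use t Tm in auto)
    moreover have "close M E2 \<A>2 e2 (restrict ?R (adjoin K g)) S"
      unfolding close_def
    proof (intro ballI)
      fix x A assume "x \<in> E2"
      then have "x \<in> K" using t2 by auto
      then have "restrict ?R (adjoin K g) x = S x" using \<rho>_K adjoin_supset[OF K] by auto
      then show "dis M (\<lambda>z. restrict ?R (adjoin K g) x z \<in> A) (\<lambda>z. S x z \<in> A) < e2"
        using t2 by (simp add: dis_def)
    qed
    ultimately show "\<exists>R\<in>actions M (adjoin K g). close M E \<A> e R T \<and> close M E2 \<A>2 e2 R S"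
      by auto
  qed
  moreover have "test M K (\<rho> ` E) \<A> (e / 2)" using t \<rho>_in by auto
  ultimately show "\<exists>E' \<A>' e'. test M K E' \<A>' e' \<and>
       (\<forall>S\<in>actions M K. close M E' \<A>' e' S T \<longrightarrow> approx_extends M T K (adjoin K g) E \<A> e S)"
    by blast
qed

section \<open>Induction from a subgroup of finite index\<close>

text \<open>For \<open>x\<close> and \<open>y\<close> in the same coset the predicates under
  \<open>SOME\<close> coincide, so the choice depends on the coset alone.\<close>

lemma coset_transversal:
  assumes K: "add_subgroup K"
    and P: "\<And>x. \<exists>y. y - x \<in> K \<and> P y"
  obtains r :: "'g::ab_group_add \<Rightarrow> 'g" where "\<And>x. r x - x \<in> K" "\<And>x. P (r x)"
    "\<And>x y. x - y \<in> K \<Longrightarrow> r x = r y" "\<And>x. r (r x) = r x"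
proof -
  define r where "r x = (SOME y. y - x \<in> K \<and> P y)" for x
  have r: "r x - x \<in> K \<and> P (r x)" for x
    unfolding r_def by (rule someI_ex[OF P])
  have "(z - x \<in> K) = (z - y \<in> K)" if "x - y \<in> K" for x y z
  proof
    assume "z - x \<in> K"
    from add_subgroupD(2)[OF K this that] show "z - y \<in> K" by simp
  next
    assume "z - y \<in> K"
    from add_subgroupD(4)[OF K this that] show "z - x \<in> K" by simp
  qed
  then have eq: "r x = r y" if "x - y \<in> K" for x y
    unfolding r_def using that by presburger
  then have "r (r x) = r x" for x using r by blast
  with r eq that show ?thesis by blast
qed

lemma emeasure_pair_pmf:
  assumes M: "prob_space M" and B: "B \<in> sets (M \<Otimes>\<^sub>M measure_pmf Q)"
  shows "emeasure (M \<Otimes>\<^sub>M measure_pmf Q) B = (\<integral>\<^sup>+q. emeasure M ((\<lambda>x. (x, q)) -` B) \<partial>measure_pmf Q)"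
proof -
  interpret M: prob_space M by fact
  interpret pair_sigma_finite M "measure_pmf Q" by standard
  show ?thesis by (rule emeasure_pair_measure_alt2[OF B])
qed

text \<open>By Fubini the distance is the average of the distances on the fibres, so a uniform
  fibrewise bound suffices.\<close>

lemma dis_pair_le:
  fixes Q :: "'i::countable pmf"
  assumes M: "prob_space M" and c: "0 \<le> c"
    and [measurable]: "Measurable.pred (M \<Otimes>\<^sub>M measure_pmf Q) P" "Measurable.pred (M \<Otimes>\<^sub>M measure_pmf Q) P'"
    and le: "\<And>q. q \<in> set_pmf Q \<Longrightarrow> dis M (\<lambda>x. P (x, q)) (\<lambda>x. P' (x, q)) \<le> c"
  shows "dis (M \<Otimes>\<^sub>M measure_pmf Q) P P' \<le> c"
proof -
  interpret M: prob_space M by fact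
  interpret N: prob_space "M \<Otimes>\<^sub>M measure_pmf Q"
    by (intro prob_space_pair M measure_pmf.prob_space_axioms)
  let ?B = "{z \<in> space (M \<Otimes>\<^sub>M measure_pmf Q). P z \<noteq> P' z}"
  have "emeasure (M \<Otimes>\<^sub>M measure_pmf Q) ?B = (\<integral>\<^sup>+q. emeasure M ((\<lambda>x. (x, q)) -` ?B) \<partial>measure_pmf Q)"
    by (rule emeasure_pair_pmf[OF M]) measurable
  also have "\<dots> \<le> (\<integral>\<^sup>+q. ennreal c \<partial>measure_pmf Q)"
  proof (rule nn_integral_mono_AE, rule AE_pmfI)
    fix q assume q: "q \<in> set_pmf Q"
    have "(\<lambda>x. (x, q)) -` ?B = {x \<in> space M. P (x, q) \<noteq> P' (x, q)}"
      by (auto simp: space_pair_measure)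
    then have "emeasure M ((\<lambda>x. (x, q)) -` ?B) = ennreal (dis M (\<lambda>x. P (x, q)) (\<lambda>x. P' (x, q)))"
      unfolding dis_def by (simp only: M.emeasure_eq_measure)
    then show "emeasure M ((\<lambda>x. (x, q)) -` ?B) \<le> ennreal c"
      using le[OF q] c by (simp only: ennreal_leI)
  qed
  also have "\<dots> = ennreal c"
    by (simp add: measure_pmf.emeasure_space_1)
  finally show ?thesis
    unfolding dis_def N.emeasure_eq_measure using c by (simp only: ennreal_le_iff)
qed

text \<open>The null set of each fibre is pulled back along \<open>fst\<close>, and countably many
  of these are united; this works for arbitrary predicates \<open>P\<close>.\<close>

lemma AE_pair_pmf:
  fixes Q :: "'i::countable pmf"
  assumes M: "prob_space M" and P: "\<And>q. q \<in> set_pmf Q \<Longrightarrow> AE x in M. P (x, q)"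
  shows "AE z in M \<Otimes>\<^sub>M measure_pmf Q. P z"
proof -
  have "AE z in M \<Otimes>\<^sub>M measure_pmf Q. q \<in> set_pmf Q \<longrightarrow> P (fst z, q)" for q
  proof (cases "q \<in> set_pmf Q")
    case True
    have "AE z in M \<Otimes>\<^sub>M measure_pmf Q. P (fst z, q)"
      by (rule AE_pullback[OF _ _ P[OF True]])
         (auto intro: prob_space.distr_pair_fst measure_pmf.prob_space_axioms)
    then show ?thesis by simp
  qed simp
  then have "AE z in M \<Otimes>\<^sub>M measure_pmf Q. \<forall>q. q \<in> set_pmf Q \<longrightarrow> P (fst z, q)"
    unfolding AE_all_countable by blast
  moreover
  interpret M: prob_space M by fact
  interpret pair_sigma_finite M "measure_pmf Q" by standard
  have "AE z in M \<Otimes>\<^sub>M measure_pmf Q. snd z \<in> set_pmf Q"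
    by (rule AE_pair_measure) (auto simp: AE_measure_pmf_iff)
  ultimately show ?thesis by eventually_elim (metis prod.collapse)
qed

text \<open>Induction from a subgroup \<open>K\<close>, where \<open>r\<close> selects a representative of each coset of \<open>K\<close>.
  As the group is abelian, \<open>k \<in> K\<close> sends \<open>(x, q)\<close>, for a representative \<open>q\<close>, to \<open>(S k x, q)\<close>.\<close>
definition induced :: "('g::ab_group_add \<Rightarrow> 'g) \<Rightarrow> ('g \<Rightarrow> 'a \<Rightarrow> 'a) \<Rightarrow> 'g \<Rightarrow> 'a \<times> 'g \<Rightarrow> 'a \<times> 'g" where
  "induced r S g = (\<lambda>(x, q). (S (g + q - r (g + q)) x, r (g + q)))"

text \<open>\<open>g\<close> permutes the finitely many representatives by
  \<open>q \<mapsto> r (g + q)\<close>, which preserves the uniform distribution, and acts between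
  fibres through elements of \<open>K\<close>. The cocycle identity for these elements gives the
  action law.\<close>

lemma mp_action_induced:
  fixes S :: "'g::{ab_group_add, countable} \<Rightarrow> 'a \<Rightarrow> 'a"
  assumes M: "prob_space M" and S: "mp_action M K S" and K: "add_subgroup K"
    and L: "add_subgroup L" "K \<subseteq> L"
    and r: "\<And>x. r x - x \<in> K" "\<And>x y. x - y \<in> K \<Longrightarrow> r x = r y"
    and fin: "finite (r ` L)"
  shows "mp_action (M \<Otimes>\<^sub>M measure_pmf (pmf_of_set (r ` L))) L (induced r S)"
proof -
  define Z where "Z = r ` L"
  define N where "N = M \<Otimes>\<^sub>M measure_pmf (pmf_of_set Z)"
  interpret M: prob_space M by fact
  have Z: "finite Z" "Z \<noteq> {}" using fin add_subgroupD(1)[OF L(1)] by (auto simp: Z_def)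
  have rr: "r (r x) = r x" for x using r by blast
  have rZ: "r q = q" if "q \<in> Z" for q using that rr by (auto simp: Z_def)
  have c: "x - r x \<in> K" for x
    using add_subgroupD(3)[OF K r(1)[of x]] by simp
  have ZL: "q \<in> L" if q: "q \<in> Z" for q
  proof -
    obtain x where x: "x \<in> L" "q = r x" using q unfolding Z_def by blast
    have "r x - x \<in> L" using r(1) L(2) by blast
    from add_subgroupD(2)[OF L(1) this x(1)] show ?thesis by (simp add: x)
  qed
  have Sm: "mp M (S k)" "S k \<in> M \<rightarrow>\<^sub>M M" if "k \<in> K" for k
    using S that unfolding mp_action_def mp_def by auto
  have sets_N: "sets N = sets (M \<Otimes>\<^sub>M count_space UNIV)"
    unfolding N_def by (rule sets_pair_measure_cong) auto
  have meas: "induced r S g \<in> N \<rightarrow>\<^sub>M N" for g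
  proof -
    have [measurable]: "S (g + q - r (g + q)) \<in> M \<rightarrow>\<^sub>M M" for q by (rule Sm(2)[OF c])
    have "(\<lambda>z. S (g + snd z - r (g + snd z)) (fst z)) \<in> M \<Otimes>\<^sub>M count_space UNIV \<rightarrow>\<^sub>M M"
      by (rule measurable_compose_countable[where f="\<lambda>q z. S (g + q - r (g + q)) (fst z)"]) measurable
    moreover have "(\<lambda>z. r (g + snd z)) \<in> M \<Otimes>\<^sub>M count_space UNIV \<rightarrow>\<^sub>M count_space UNIV"
      by (rule measurable_compose[OF measurable_snd]) simp
    ultimately have "induced r S g \<in> M \<Otimes>\<^sub>M count_space UNIV \<rightarrow>\<^sub>M M \<Otimes>\<^sub>M count_space UNIV"
      unfolding induced_def split_beta' by (rule measurable_Pair)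
    then show ?thesis unfolding measurable_cong_sets[OF sets_N sets_N] .
  qed
  have setZ: "set_pmf (pmf_of_set Z) = Z" using Z by simp
  have "distr N N (induced r S g) = N" if g: "g \<in> L" for g
  proof (rule measure_eqI)
    fix B assume "B \<in> sets (distr N N (induced r S g))"
    then have B: "B \<in> sets N" by simp
    \<comment> \<open>\<open>h q\<close> is the measure of the fibre of \<open>B\<close> over
      \<open>q\<close>. The fibre of the preimage over \<open>q\<close> has measure
      \<open>h (r (g + q))\<close>, so invariance reduces to reindexing a sum over
      \<open>Z\<close>.\<close>
    define h where "h q = emeasure M ((\<lambda>x. (x, q)) -` B)" for q
    have "(\<lambda>x. (x, q)) -` (induced r S g -` B \<inter> space N)
        = S (g + q - r (g + q)) -` ((\<lambda>x. (x, r (g + q))) -` B) \<inter> space M" for q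
      by (auto simp: induced_def N_def space_pair_measure)
    moreover have "emeasure M (S k -` ((\<lambda>x. (x, q)) -` B) \<inter> space M) = h q" if "k \<in> K" for k q
    proof -
      have "(\<lambda>x. (x, q)) -` B \<in> sets M" by (rule sets_Pair2[OF B[unfolded N_def]])
      from emeasure_distr[OF Sm(2)[OF that] this] show ?thesis
        using Sm(1)[OF that] unfolding mp_def h_def by simp
    qed
    ultimately have h: "emeasure M ((\<lambda>x. (x, q)) -` (induced r S g -` B \<inter> space N)) = h (r (g + q))" for q
      using c by simp
    have "inj_on (\<lambda>q. r (g + q)) Z"
    proof (rule inj_onI)
      fix q q' assume q: "q \<in> Z" "q' \<in> Z" and "r (g + q) = r (g + q')"
      then have "q - q' = (r (g + q') - (g + q')) - (r (g + q) - (g + q))" by simp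
      then have "q - q' \<in> K" using add_subgroupD(4)[OF K r(1) r(1)] by metis
      from r(2)[OF this] show "q = q'" using q rZ by simp
    qed
    moreover have "(\<lambda>q. r (g + q)) ` Z \<subseteq> Z"
      using add_subgroupD(2)[OF L(1) g] ZL unfolding Z_def by blast
    ultimately have "bij_betw (\<lambda>q. r (g + q)) Z Z"
      unfolding bij_betw_def using endo_inj_surj[OF Z(1)] by blast
    then have map: "map_pmf (\<lambda>q. r (g + q)) (pmf_of_set Z) = pmf_of_set Z"
      by (rule map_pmf_of_set_bij_betw[OF _ Z(2,1)])
    have "emeasure (distr N N (induced r S g)) B = emeasure N (induced r S g -` B \<inter> space N)"
      by (rule emeasure_distr[OF meas B])
    also have "\<dots> = (\<integral>\<^sup>+q. h (r (g + q)) \<partial>measure_pmf (pmf_of_set Z))"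
      unfolding h[symmetric] N_def
      by (rule emeasure_pair_pmf[OF M]) (rule measurable_sets[OF meas B, unfolded N_def])
    also have "\<dots> = (\<integral>\<^sup>+q. h q \<partial>measure_pmf (map_pmf (\<lambda>q. r (g + q)) (pmf_of_set Z)))"
      by simp
    also have "\<dots> = emeasure N B"
      unfolding map h_def N_def by (rule emeasure_pair_pmf[OF M B[unfolded N_def], symmetric])
    finally show "emeasure (distr N N (induced r S g)) B = emeasure N B" .
  qed simp
  then have "mp N (induced r S g)" if "g \<in> L" for g
    using meas that unfolding mp_def by blast
  moreover have "AE z in N. induced r S 0 z = z"
    unfolding N_def
  proof (rule AE_pair_pmf[OF M])
    fix q assume "q \<in> set_pmf (pmf_of_set Z)"
    then have "r q = q" using setZ rZ by blast
    then show "AE x in M. induced r S 0 (x, q) = (x, q)"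
      using S unfolding mp_action_def by (simp add: induced_def)
  qed
  moreover have "AE z in N. induced r S (g + h) z = induced r S g (induced r S h z)" for g h
    unfolding N_def
  proof (rule AE_pair_pmf[OF M])
    fix q
    \<comment> \<open>Passing to a representative after the first translation stays in the same
      coset, so both sides end at the same representative.\<close>
    have "(g + r (h + q)) - (g + h + q) = r (h + q) - (h + q)" by simp
    then have "(g + r (h + q)) - (g + h + q) \<in> K" using r(1) by metis
    then have req: "r (g + r (h + q)) = r (g + h + q)" by (rule r(2))
    have "AE x in M. S ((g + r (h + q) - r (g + h + q)) + (h + q - r (h + q))) x
        = S (g + r (h + q) - r (g + h + q)) (S (h + q - r (h + q)) x)"
      using S c[of "h + q"] c[of "g + r (h + q)"] unfolding mp_action_def req by blast
    moreover have "(g + r (h + q) - r (g + h + q)) + (h + q - r (h + q)) = g + h + q - r (g + h + q)"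
      by simp
    ultimately show "AE x in M. induced r S (g + h) (x, q) = induced r S g (induced r S h (x, q))"
      by (simp add: induced_def req)
  qed
  ultimately show ?thesis unfolding mp_action_def N_def Z_def by blast
qed

text \<open>The representatives \<open>q\<close> are chosen with \<open>T q\<close> close to the identity, so that \<open>T (g + q - r (g + q))\<close>
  is close to \<open>T g\<close>.\<close>
lemma extension_finite_index:
  fixes T :: "'g::{ab_group_add, countable} \<Rightarrow> 'a \<Rightarrow> 'a"
  assumes M: "prob_space M" "encodable M" and atomless: "\<And>x. x \<in> space M \<Longrightarrow> emeasure M {x} = 0"
    and T: "mp_action M UNIV T" and K: "add_subgroup K" and L: "add_subgroup L" "K \<subseteq> L"
    and dense: "dense_in_orbit M T K"
    and Z0: "finite Z0" "\<And>x. x \<in> L \<Longrightarrow> \<exists>z\<in>Z0. x - z \<in> K"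
  shows "locally_dense_extension M T K L"
proof (rule locally_dense_extensionI)
  fix E \<A> e assume t: "test M L E \<A> e"
  interpret M: prob_space M by fact
  have Mf: "finite_measure M" by (rule M.finite_measure_axioms)
  have Tm: "T g \<in> M \<rightarrow>\<^sub>M M" for g using T unfolding mp_action_def mp_def by auto
  \<comment> \<open>If \<open>h \<in> K\<close> approximates \<open>x\<close> in the action, then
    \<open>x - h\<close> lies in the coset of \<open>x\<close> and moves the sets of
    \<open>\<A>\<close> only slightly.\<close>
  have "\<exists>y. y - x \<in> K \<and> (\<forall>A\<in>\<A>. displacement M (T y) A < e / 4)" for x
  proof -
    have "0 < e / 4" using t by simp
    then obtain h where "h \<in> K" "\<forall>A\<in>\<A>. displacement M (T (x - h)) A < e / 4"
      using dense t unfolding dense_in_orbit_def by blast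
    then show ?thesis using add_subgroupD(3)[OF K] by (intro exI[of _ "x - h"]) simp
  qed
  then obtain r where r: "\<And>x. r x - x \<in> K" and r_close: "\<And>x. \<forall>A\<in>\<A>. displacement M (T (r x)) A < e / 4"
    and r_eq: "\<And>x y. x - y \<in> K \<Longrightarrow> r x = r y" and rr: "\<And>x. r (r x) = r x"
    using coset_transversal[OF K, of "\<lambda>y. \<forall>A\<in>\<A>. displacement M (T y) A < e / 4"] by blast
  define Z where "Z = r ` L"
  have "Z \<subseteq> r ` Z0"
  proof
    fix q assume "q \<in> Z"
    then obtain x where x: "x \<in> L" "q = r x" unfolding Z_def by blast
    then obtain z where "z \<in> Z0" "x - z \<in> K" using Z0 by blast
    then show "q \<in> r ` Z0" using r_eq x by blast
  qed
  then have Z: "finite Z" "Z \<noteq> {}"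
    using Z0(1) finite_subset add_subgroupD(1)[OF L(1)] unfolding Z_def by (blast, blast)
  have rZ: "r q = q" if "q \<in> Z" for q using that rr by (auto simp: Z_def)
  have setZ: "set_pmf (pmf_of_set Z) = Z" using Z by simp
  \<comment> \<open>These finitely many elements of \<open>K\<close> are the ones through which the
    induced action of \<open>E\<close> moves the fibres.\<close>
  define E1 where "E1 = (\<lambda>(g, q). g + q - r (g + q)) ` (E \<times> Z)"
  have c: "x - r x \<in> K" for x
    using add_subgroupD(3)[OF K r[of x]] by simp
  have t1: "test M K E1 \<A> (e / 4)" using t Z c unfolding E1_def by auto
  \<comment> \<open>As \<open>r q = q\<close>, the element differs from \<open>g\<close> by
    \<open>r q - r (g + q)\<close>, and each representative contributes a displacement below
    \<open>e / 4\<close>.\<close>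
  have T_close: "dis M (\<lambda>x. T (g + q - r (g + q)) x \<in> A) (\<lambda>x. T g x \<in> A) < e / 2"
    if A: "A \<in> \<A>" and q: "q \<in> Z" for g q A
  proof -
    have A': "A \<in> sets M" using A t by auto
    have "dis M (\<lambda>x. T (g + q - r (g + q)) x \<in> A) (\<lambda>x. T g x \<in> A) = displacement M (T (r q + - r (g + q))) A"
      unfolding dis_action[OF T A'] by (simp add: rZ[OF q])
    also have "\<dots> \<le> displacement M (T (r q)) A + displacement M (T (r (g + q))) A"
      using displacement_add[OF T Mf A'] displacement_minus[OF T Mf A'] by metis
    also have "\<dots> < e / 4 + e / 4" using r_close A by (intro add_strict_mono) blast+
    finally show ?thesis by simp
  qed
  have "approx_extends M T K L E \<A> e S" if S: "S \<in> actions M K" and S_close: "close M E1 \<A> (e / 4) S T" for S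
  proof (rule approx_extendsI)
    fix E2 \<A>2 e2 assume t2: "test M K E2 \<A>2 e2"
    note Sm = actionsD(3)[OF S]
    define N where "N = M \<Otimes>\<^sub>M measure_pmf (pmf_of_set Z)"
    have R: "mp_action N L (induced r S)"
      unfolding N_def Z_def
      using mp_action_induced[OF M(1) actions_mp_action[OF S add_subgroupD(1)[OF K]] K L r r_eq] Z(1) Z_def
      by blast
    have Rm: "induced r S g \<in> N \<rightarrow>\<^sub>M N" if "g \<in> L" for g
      using R that unfolding mp_action_def mp_def by blast
    have N: "prob_space N" unfolding N_def
      by (intro prob_space_pair M measure_pmf.prob_space_axioms)
    have "sets N = sets (M \<Otimes>\<^sub>M count_space UNIV)"
      unfolding N_def by (rule sets_pair_measure_cong) auto
    from encodable_cong[OF this] have enc: "encodable N"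
      using encodable_pair_countable[OF M(2)] by blast
    have p: "fst \<in> N \<rightarrow>\<^sub>M M" "distr N M fst = M"
      unfolding N_def by (auto intro!: prob_space.distr_pair_fst measure_pmf.prob_space_axioms)
    \<comment> \<open>The preimages under \<open>T g\<close> and \<open>S g\<close> are included so
      that closeness to \<open>T\<close> and to \<open>S\<close> is expressed by distances to sets
      of the family.\<close>
    define \<B> where "\<B> = \<A> \<union> \<A>2 \<union> (\<lambda>(g, A). T g -` A \<inter> space M) ` (E \<times> \<A>) \<union>
      (\<lambda>(g, A). S g -` A \<inter> space M) ` (E2 \<times> \<A>2)"
    have \<B>: "finite \<B>" using t t2 unfolding \<B>_def by simp
    have "T g -` A \<inter> space M \<in> sets M" if "A \<in> \<A>" for g A
      using that t measurable_sets[OF Tm] by blast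
    moreover have "S g -` A \<inter> space M \<in> sets M" if "A \<in> \<A>2" "g \<in> E2" for g A
      using that t2 measurable_sets[OF Sm] by blast
    ultimately have \<B>': "\<B> \<subseteq> sets M" using t t2 unfolding \<B>_def by auto
    obtain R' where R': "R' \<in> actions M L" and dis_R': "\<And>g A C. g \<in> L \<Longrightarrow> A \<in> \<B> \<Longrightarrow> C \<in> \<B> \<Longrightarrow>
      dis M (\<lambda>x. R' g x \<in> A) (\<lambda>x. x \<in> C) = dis N (\<lambda>y. fst (induced r S g y) \<in> A) (\<lambda>y. fst y \<in> C)"
      using transfer_action[OF N enc M atomless p \<B> \<B>' L(1) R] by blast
    have dis_vimage: "dis M P (\<lambda>x. x \<in> f -` A \<inter> space M) = dis M P (\<lambda>x. f x \<in> A)" for P f A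
      unfolding dis_def by (rule arg_cong[where f="measure M"]) auto
    have bound: "dis N (\<lambda>y. fst (induced r S g y) \<in> A) (\<lambda>y. fst y \<in> C) \<le> b"
      if "g \<in> L" and "A \<in> sets M" "C \<in> sets M" "0 \<le> b"
        and "\<And>q. q \<in> Z \<Longrightarrow> dis M (\<lambda>x. S (g + q - r (g + q)) x \<in> A) (\<lambda>x. x \<in> C) \<le> b" for g A C b
      unfolding N_def
    proof (rule dis_pair_le[OF M(1) \<open>0 \<le> b\<close>])
      note [measurable] = Rm[OF \<open>g \<in> L\<close>, unfolded N_def] \<open>A \<in> sets M\<close> \<open>C \<in> sets M\<close>
      show "Measurable.pred (M \<Otimes>\<^sub>M measure_pmf (pmf_of_set Z)) (\<lambda>y. fst (induced r S g y) \<in> A)"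
        "Measurable.pred (M \<Otimes>\<^sub>M measure_pmf (pmf_of_set Z)) (\<lambda>y. fst y \<in> C)"
        by measurable
    qed (use that setZ in \<open>simp add: induced_def\<close>)
    have "close M E \<A> e R' T"
      unfolding close_def
    proof (intro ballI)
      fix g A assume g: "g \<in> E" and A: "A \<in> \<A>"
      have gL: "g \<in> L" and A': "A \<in> sets M" using t g A by auto
      let ?C = "T g -` A \<inter> space M"
      have AB: "A \<in> \<B>" "?C \<in> \<B>" using g A unfolding \<B>_def by auto
      have "dis M (\<lambda>x. R' g x \<in> A) (\<lambda>x. T g x \<in> A)
          = dis N (\<lambda>y. fst (induced r S g y) \<in> A) (\<lambda>y. fst y \<in> ?C)"
        unfolding dis_R'[OF gL AB, symmetric] dis_vimage ..
      \<comment> \<open>On each fibre, \<open>e / 4\<close> comes from \<open>S\<close> versus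
        \<open>T\<close> on \<open>E1\<close> and \<open>e / 2\<close> from \<open>T_close\<close>;
        averaging keeps a weak bound, still below \<open>e\<close>.\<close>
      also have "\<dots> \<le> 3 * e / 4"
      proof (rule bound[OF gL A'])
        show "?C \<in> sets M" using AB \<B>' by blast
        show "0 \<le> 3 * e / 4" using t by simp
        fix q assume q: "q \<in> Z"
        let ?k = "g + q - r (g + q)"
        note [measurable] = Sm[OF c] Tm A'
        have "dis M (\<lambda>x. S ?k x \<in> A) (\<lambda>x. T g x \<in> A)
          \<le> dis M (\<lambda>x. S ?k x \<in> A) (\<lambda>x. T ?k x \<in> A) + dis M (\<lambda>x. T ?k x \<in> A) (\<lambda>x. T g x \<in> A)"
          by (rule M.dis_triangle) measurable
        moreover have "?k \<in> E1" using g q unfolding E1_def by force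
        then have "dis M (\<lambda>x. S ?k x \<in> A) (\<lambda>x. T ?k x \<in> A) < e / 4"
          using S_close A unfolding close_def by blast
        moreover note T_close[OF A q, of g]
        ultimately show "dis M (\<lambda>x. S ?k x \<in> A) (\<lambda>x. x \<in> ?C) \<le> 3 * e / 4"
          unfolding dis_vimage by linarith
      qed
      also have "\<dots> < e" using t by simp
      finally show "dis M (\<lambda>x. R' g x \<in> A) (\<lambda>x. T g x \<in> A) < e" .
    qed
    moreover have "close M E2 \<A>2 e2 R' S"
      unfolding close_def
    proof (intro ballI)
      fix g A assume g: "g \<in> E2" and A: "A \<in> \<A>2"
      have gK: "g \<in> K" and gL: "g \<in> L" and A': "A \<in> sets M" using t2 g A L by auto
      let ?C = "S g -` A \<inter> space M"
      have AB: "A \<in> \<B>" "?C \<in> \<B>" using g A unfolding \<B>_def by auto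
      have "dis M (\<lambda>x. R' g x \<in> A) (\<lambda>x. S g x \<in> A)
          = dis N (\<lambda>y. fst (induced r S g y) \<in> A) (\<lambda>y. fst y \<in> ?C)"
        unfolding dis_R'[OF gL AB, symmetric] dis_vimage ..
      also have "\<dots> \<le> 0"
      proof (rule bound[OF gL A'])
        show "?C \<in> sets M" using AB \<B>' by blast
        fix q assume q: "q \<in> Z"
        \<comment> \<open>Translation by \<open>g \<in> K\<close> fixes every coset, so on each
          fibre the induced action is \<open>S g\<close> itself and the error is zero.\<close>
        have "r (g + q) = r q" by (rule r_eq) (simp add: gK)
        then have "g + q - r (g + q) = g" using rZ[OF q] by simp
        then show "dis M (\<lambda>x. S (g + q - r (g + q)) x \<in> A) (\<lambda>x. x \<in> ?C) \<le> 0"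
          unfolding dis_vimage by (simp add: dis_def)
      qed simp
      also have "\<dots> < e2" using t2 by simp
      finally show "dis M (\<lambda>x. R' g x \<in> A) (\<lambda>x. S g x \<in> A) < e2" .
    qed
    ultimately show "\<exists>R\<in>actions M L. close M E \<A> e R T \<and> close M E2 \<A>2 e2 R S"
      using R' by blast
  qed
  with t1 show "\<exists>E' \<A>' e'. test M K E' \<A>' e' \<and>
       (\<forall>S\<in>actions M K. close M E' \<A>' e' S T \<longrightarrow> approx_extends M T K L E \<A> e S)"
    by blast
qed

section \<open>Finitely generated extensions\<close>

text \<open>Either \<open>g\<close> is free over \<open>K\<close>, or some multiple
  \<open>nmul n g\<close> with \<open>n > 0\<close> lies in \<open>K\<close> and the first
  \<open>n\<close> multiples of \<open>g\<close> meet every coset.\<close>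

lemma extension_adjoin:
  fixes T :: "'g::{ab_group_add, countable} \<Rightarrow> 'a \<Rightarrow> 'a"
  assumes M: "prob_space M" "encodable M" and atomless: "\<And>x. x \<in> space M \<Longrightarrow> emeasure M {x} = 0"
    and T: "mp_action M UNIV T" and K: "add_subgroup K" and dense: "dense_in_orbit M T K"
  shows "locally_dense_extension M T K (adjoin K g)"
proof (cases "\<exists>n>0. nmul n g \<in> K")
  case False
  then show ?thesis
    by (intro extension_free[OF prob_space.finite_measure[OF M(1)] T K dense]) blast
next
  case True
  then obtain n where n: "0 < n" "nmul n g \<in> K" by blast
  show ?thesis
  proof (rule extension_finite_index[OF M atomless T K add_subgroup_adjoin[OF K] adjoin_supset[OF K] dense])
    show "finite ((\<lambda>i. nmul i g) ` {..<n})" by simp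
    fix x assume "x \<in> adjoin K g"
    then obtain k a b where k: "k \<in> K" and x: "x = k + nmul a g - nmul b g"
      unfolding adjoin_def by blast
    \<comment> \<open>Modulo \<open>nmul n g \<in> K\<close>, the coefficient \<open>- b\<close> may
      be replaced by \<open>b * (n - 1)\<close>, which makes the total a natural number that can be
      reduced modulo \<open>n\<close>.\<close>
    define m where "m = a + b * (n - 1)"
    have "nmul m g = nmul (m div n * n + m mod n) g" by simp
    then have m: "nmul m g = nmul (m div n) (nmul n g) + nmul (m mod n) g"
      unfolding nmul_add nmul_mult .
    have "b * (n - 1) + b = b * n" using n(1) by (cases n) auto
    then have b: "nmul (b * (n - 1)) g + nmul b g = nmul b (nmul n g)"
      unfolding nmul_add[symmetric] nmul_mult[symmetric] by (simp only:)
    have "x - nmul (m mod n) g = k + nmul m g - nmul (m mod n) g - (nmul (b * (n - 1)) g + nmul b g)"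
      unfolding x m_def nmul_add by (simp add: algebra_simps)
    also have "\<dots> = k + nmul (m div n) (nmul n g) - nmul b (nmul n g)"
      unfolding m b by (simp add: algebra_simps)
    also have "\<dots> \<in> K" using k n(2) K by (simp add: add_subgroupD nmul_closed)
    finally show "\<exists>z\<in>(\<lambda>i. nmul i g) ` {..<n}. x - z \<in> K" using n(1) by auto
  qed
qed

lemma dense_in_orbit_mono: "dense_in_orbit M T H \<Longrightarrow> H \<subseteq> K \<Longrightarrow> dense_in_orbit M T K"
  unfolding dense_in_orbit_def by blast

text \<open>The elements of \<open>E\<close> are adjoined one at a time; density passes from
  \<open>H\<close> to every larger subgroup, so each step applies to the same
  \<open>T\<close>.\<close>

lemma extension_finitely_generated:
  fixes T :: "'g::{ab_group_add, countable} \<Rightarrow> 'a \<Rightarrow> 'a"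
  assumes M: "prob_space M" "encodable M" and atomless: "\<And>x. x \<in> space M \<Longrightarrow> emeasure M {x} = 0"
    and T: "mp_action M UNIV T" and H: "add_subgroup H" and dense: "dense_in_orbit M T H"
    and E: "finite E"
  shows "\<exists>K. add_subgroup K \<and> H \<subseteq> K \<and> E \<subseteq> K \<and> locally_dense_extension M T H K"
  using E
proof (induction rule: finite_induct)
  case empty
  then show ?case using H locally_dense_extension_refl by blast
next
  case (insert g E)
  then obtain K where K: "add_subgroup K" "H \<subseteq> K" "E \<subseteq> K" "locally_dense_extension M T H K" by blast
  note sup = adjoin_supset[OF K(1), of g]
  have "locally_dense_extension M T K (adjoin K g)"
    by (rule extension_adjoin[OF M atomless T K(1) dense_in_orbit_mono[OF dense K(2)]])
  from locally_dense_extension_trans[OF prob_space.finite_measure[OF M(1)] K(2) sup K(4) this]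
  show ?case
    using K add_subgroup_adjoin[OF K(1), of g] mem_adjoin[OF K(1), of g] sup
    by (intro exI[of _ "adjoin K g"]) auto
qed

section \<open>Coinduction to the whole group\<close>

text \<open>Preimages of cylinders are cylinders whose sides have the same measures, and cylinders
  determine the product measure.\<close>

lemma distr_PiM_componentwise:
  assumes M: "\<And>i. i \<in> I \<Longrightarrow> prob_space (M i)" and f: "\<And>i. i \<in> I \<Longrightarrow> mp (M i) (f i)"
  shows "distr (PiM I M) (PiM I M) (\<lambda>y. \<lambda>i\<in>I. f i (y i)) = PiM I M"
proof (rule measure_eqI_PiM_infinite[symmetric, OF refl])
  interpret prob_space "PiM I M" using M by (rule prob_space_PiM)
  show "finite_measure (PiM I M)" by (rule finite_measure_axioms)
  have fm [measurable]: "f i \<in> M i \<rightarrow>\<^sub>M M i" and fd: "distr (M i) (M i) (f i) = M i" if "i \<in> I" for i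
    using f[OF that] unfolding mp_def by auto
  have meas: "(\<lambda>y. \<lambda>i\<in>I. f i (y i)) \<in> PiM I M \<rightarrow>\<^sub>M PiM I M"
    by (intro measurable_restrict measurable_PiM_component_rev fm)
  fix A J assume J: "finite J" "J \<subseteq> I" and A: "\<And>i. i \<in> J \<Longrightarrow> A i \<in> sets (M i)"
  have A': "f i -` A i \<inter> space (M i) \<in> sets (M i)" if "i \<in> J" for i
    using J that by (intro measurable_sets[OF fm] A) auto
  have "PiM I M (prod_emb I M J (Pi\<^sub>E J A)) = (\<Prod>j\<in>J. M j (A j))"
    using J A by (intro emeasure_PiM_emb M) auto
  also have "\<dots> = (\<Prod>j\<in>J. M j (f j -` A j \<inter> space (M j)))"
  proof (rule prod.cong[OF refl])
    fix j assume j: "j \<in> J"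
    then have "j \<in> I" using J by auto
    from emeasure_distr[OF fm[OF this] A[OF j]] fd[OF this]
    show "emeasure (M j) (A j) = emeasure (M j) (f j -` A j \<inter> space (M j))" by simp
  qed
  also have "\<dots> = PiM I M (prod_emb I M J (\<Pi>\<^sub>E j\<in>J. f j -` A j \<inter> space (M j)))"
    using J A' by (intro emeasure_PiM_emb[symmetric] M) auto
  also have "prod_emb I M J (\<Pi>\<^sub>E j\<in>J. f j -` A j \<inter> space (M j))
      = (\<lambda>y. \<lambda>i\<in>I. f i (y i)) -` prod_emb I M J (Pi\<^sub>E J A) \<inter> space (PiM I M)"
    using J measurable_space[OF fm] by (auto simp: prod_emb_def space_PiM PiE_iff Pi_iff subset_iff)
  also have "emeasure (PiM I M) \<dots> = distr (PiM I M) (PiM I M) (\<lambda>y. \<lambda>i\<in>I. f i (y i)) (prod_emb I M J (Pi\<^sub>E J A))"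
    using J A by (intro emeasure_distr[OF meas, symmetric] sets_PiM_I) auto
  finally show "PiM I M (prod_emb I M J (Pi\<^sub>E J A))
    = distr (PiM I M) (PiM I M) (\<lambda>y. \<lambda>i\<in>I. f i (y i)) (prod_emb I M J (Pi\<^sub>E J A))" .
qed simp

text \<open>Coinduction from \<open>K\<close> to the whole group, on \<open>X\<^sup>G\<close>.  Writing \<open>j = r j + k\<close> identifies the index set
  with (cosets) \<open>\<times>\<close> \<open>K\<close>; the group permutes the cosets and leaves the second factor fixed.\<close>
definition coinduced :: "('g::ab_group_add \<Rightarrow> 'g) \<Rightarrow> ('g \<Rightarrow> 'a \<Rightarrow> 'a) \<Rightarrow> 'g \<Rightarrow> ('g \<Rightarrow> 'a) \<Rightarrow> 'g \<Rightarrow> 'a" where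
  "coinduced r S g y = (\<lambda>j. S (g + r (j - g) - r j) (y (r (j - g) + j - r j)))"

text \<open>Each map is a permutation \<open>\<pi> g\<close> of the coordinates followed by maps
  \<open>S (c g j)\<close> in the single coordinates, and both preserve the product measure. The
  action law combines the composition rule for \<open>\<pi>\<close> with the cocycle identity for
  \<open>c\<close>.\<close>

lemma mp_action_coinduced:
  fixes S :: "'g::{ab_group_add, countable} \<Rightarrow> 'a \<Rightarrow> 'a"
  assumes M: "prob_space M" and S: "mp_action M K S" and K: "add_subgroup K"
    and r: "\<And>x. r x - x \<in> K" "\<And>x y. x - y \<in> K \<Longrightarrow> r x = r y"
  shows "mp_action (PiM UNIV (\<lambda>_::'g. M)) UNIV (coinduced r S)"
proof -
  define N where "N = PiM UNIV (\<lambda>_::'g. M)"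
  define c where "c g j = g + r (j - g) - r j" for g j
  define \<pi> where "\<pi> g j = r (j - g) + j - r j" for g j
  have coind: "coinduced r S g y = (\<lambda>j. S (c g j) (y (\<pi> g j)))" for g y
    unfolding coinduced_def c_def \<pi>_def ..
  have c: "c g j \<in> K" for g j
  proof -
    have "c g j = (r (j - g) - (j - g)) - (r j - j)" unfolding c_def by simp
    then show ?thesis using add_subgroupD(4)[OF K r(1) r(1)] by metis
  qed
  \<comment> \<open>\<open>\<pi> g j\<close> and \<open>j - g\<close> lie in the same coset, and
    \<open>r\<close> depends on the coset alone.\<close>
  have r\<pi>: "r (\<pi> g j - h) = r (j - g - h)" for g h j
  proof (rule r(2))
    have "\<pi> g j - h - (j - g - h) = (r (j - g) - (j - g)) - (r j - j)" unfolding \<pi>_def by simp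
    then show "\<pi> g j - h - (j - g - h) \<in> K" using add_subgroupD(4)[OF K r(1) r(1)] by metis
  qed
  have r\<pi>0: "r (\<pi> g j) = r (j - g)" for g j using r\<pi>[of g j 0] by simp
  have \<pi>\<pi>: "\<pi> h (\<pi> g j) = \<pi> (g + h) j" for g h j
    unfolding \<pi>_def[of h] r\<pi> r\<pi>0 by (simp add: \<pi>_def algebra_simps)
  have cc: "c g j + c h (\<pi> g j) = c (g + h) j" for g h j
    unfolding c_def[of h] r\<pi> r\<pi>0 by (simp add: c_def algebra_simps)
  have c0: "c 0 j = 0" and \<pi>0: "\<pi> 0 j = j" for j unfolding c_def \<pi>_def by simp_all
  have inj: "inj (\<pi> g)" for g
  proof (rule injI)
    fix i j assume "\<pi> g i = \<pi> g j"
    then have "\<pi> (g + - g) i = \<pi> (g + - g) j" unfolding \<pi>\<pi>[symmetric] by simp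
    then show "i = j" by (simp add: \<pi>0)
  qed
  have AE_comp: "AE y in N. \<forall>j. P j (y (s j))" if "\<And>j. AE x in M. P j x" for P and s :: "'g \<Rightarrow> 'g"
    unfolding AE_all_countable N_def
    by (intro allI AE_PiM_component[where P="P _"] that M) auto
  have Smp: "mp M (S (c g j))" for g j using S c unfolding mp_action_def by blast
  have "mp N (coinduced r S g)" for g
  proof -
    let ?F = "\<lambda>y. \<lambda>j\<in>UNIV. S (c g j) (y j)" and ?P = "\<lambda>y. \<lambda>j\<in>UNIV. y (\<pi> g j)"
    have Sm: "S (c g j) \<in> M \<rightarrow>\<^sub>M M" for j using Smp unfolding mp_def by blast
    have F: "?F \<in> N \<rightarrow>\<^sub>M N" unfolding N_def
      by (intro measurable_restrict measurable_PiM_component_rev Sm) auto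
    have P: "?P \<in> N \<rightarrow>\<^sub>M N" unfolding N_def
      by (intro measurable_restrict measurable_component_singleton) auto
    have "distr N N ?F = N" unfolding N_def
      by (rule distr_PiM_componentwise) (auto intro: M Smp)
    moreover have "distr N N ?P = N" unfolding N_def
      by (rule distr_PiM_reindex) (auto intro: M inj)
    ultimately have "distr N N (?F \<circ> ?P) = N" using distr_distr[OF F P] by simp
    moreover have "coinduced r S g = ?F \<circ> ?P" by (simp add: coind fun_eq_iff)
    moreover have "?F \<circ> ?P \<in> N \<rightarrow>\<^sub>M N" by (rule measurable_comp[OF P F])
    ultimately show ?thesis unfolding mp_def by simp
  qed
  moreover have "AE y in N. coinduced r S 0 y = y"
  proof -
    have "AE x in M. S 0 x = x" using S unfolding mp_action_def by blast
    then have "AE y in N. \<forall>j. S 0 (y j) = y j" by (rule AE_comp)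
    then show ?thesis by eventually_elim (simp add: coind c0 \<pi>0)
  qed
  moreover have "AE y in N. coinduced r S (g + h) y = coinduced r S g (coinduced r S h y)" for g h
  proof -
    have "AE x in M. S (c g j + c h (\<pi> g j)) x = S (c g j) (S (c h (\<pi> g j)) x)" for j
      using S c unfolding mp_action_def by blast
    then have "AE y in N. \<forall>j. S (c g j + c h (\<pi> g j)) (y (\<pi> (g + h) j))
        = S (c g j) (S (c h (\<pi> g j)) (y (\<pi> (g + h) j)))"
      by (rule AE_comp)
    then show ?thesis by eventually_elim (simp add: coind cc \<pi>\<pi>)
  qed
  ultimately show ?thesis unfolding mp_action_def N_def by blast
qed

text \<open>For elements of \<open>K\<close>, the projection to coordinate 0 intertwines the
  coinduced action with \<open>S\<close>. Transferring along this projection with a suitable finite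
  family makes the distances to \<open>S\<close> in the test vanish.\<close>

lemma coinduced_extension:
  fixes M :: "'a::polish_space measure" and S :: "'g::{ab_group_add, countable} \<Rightarrow> 'a \<Rightarrow> 'a"
  assumes M: "std_atomless_prob M" and K: "add_subgroup K" and S: "S \<in> actions M K"
    and t: "test M K E \<A> e"
  shows "\<exists>R\<in>actions M UNIV. close M E \<A> e R S"
proof -
  note M' = std_atomless_probD[OF M]
  note Sm = actionsD(3)[OF S]
  obtain r where r: "\<And>x. r x - x \<in> K" "\<And>x y. x - y \<in> K \<Longrightarrow> r x = r y"
    using coset_transversal[OF K, of "\<lambda>_. True"] add_subgroupD(1)[OF K] by (metis diff_self)
  define N where "N = PiM UNIV (\<lambda>_::'g. M)"
  have R: "mp_action N UNIV (coinduced r S)" unfolding N_def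
    by (rule mp_action_coinduced[OF M'(1) actions_mp_action[OF S add_subgroupD(1)[OF K]] K r])
  have N: "prob_space N" unfolding N_def by (rule prob_space_PiM) (rule M')
  have "sets N = sets (PiM UNIV (\<lambda>_::'g. borel :: 'a measure))"
    unfolding N_def by (rule sets_PiM_cong) (auto simp: M')
  then have enc: "encodable N" by (intro encodable_polish) (simp only: sets_PiM_equal_borel)
  have p: "(\<lambda>y. y 0) \<in> N \<rightarrow>\<^sub>M M" "distr N M (\<lambda>y. y 0) = M"
    unfolding N_def by (auto intro!: distr_PiM_component[of UNIV "\<lambda>_. M"] M')
  define \<B> where "\<B> = \<A> \<union> (\<lambda>(g, A). S g -` A \<inter> space M) ` (E \<times> \<A>)"
  have \<B>: "finite \<B>" using t unfolding \<B>_def by simp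
  have "S g -` A \<inter> space M \<in> sets M" if "A \<in> \<A>" "g \<in> E" for g A
    using that t measurable_sets[OF Sm] by blast
  then have \<B>': "\<B> \<subseteq> sets M" using t unfolding \<B>_def by auto
  obtain R' where R': "R' \<in> actions M UNIV" and dis_R': "\<And>g A C. A \<in> \<B> \<Longrightarrow> C \<in> \<B> \<Longrightarrow>
    dis M (\<lambda>x. R' g x \<in> A) (\<lambda>x. x \<in> C) = dis N (\<lambda>y. coinduced r S g y 0 \<in> A) (\<lambda>y. y 0 \<in> C)"
    using transfer_action[OF N enc M'(1,4,5) p \<B> \<B>' _ R] unfolding add_subgroup_def by auto
  have "close M E \<A> e R' S"
    unfolding close_def
  proof (intro ballI)
    fix g A assume g: "g \<in> E" and A: "A \<in> \<A>"
    let ?C = "S g -` A \<inter> space M"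
    have AB: "A \<in> \<B>" "?C \<in> \<B>" using g A unfolding \<B>_def by auto
    have "- g \<in> K" using g t add_subgroupD(3)[OF K] by blast
    \<comment> \<open>Hence at coordinate 0 the acting element is \<open>g\<close> and the source
      coordinate is again 0.\<close>
    then have "r (0 - g) = r 0" by (intro r(2)) simp
    then have "coinduced r S g y 0 = S g (y 0)" for y unfolding coinduced_def by simp
    then have "dis N (\<lambda>y. coinduced r S g y 0 \<in> A) (\<lambda>y. y 0 \<in> ?C) = 0"
      unfolding dis_def by (simp add: M'(3))
    then have "dis M (\<lambda>x. R' g x \<in> A) (\<lambda>x. x \<in> ?C) = 0" unfolding dis_R'[OF AB] .
    then have "dis M (\<lambda>x. R' g x \<in> A) (\<lambda>x. S g x \<in> A) = 0" by (simp add: M'(3))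
    then show "dis M (\<lambda>x. R' g x \<in> A) (\<lambda>x. S g x \<in> A) < e" using t by simp
  qed
  with R' show ?thesis by blast
qed

section \<open>The weak topology\<close>

lemma inv_aut:
  assumes "f \<in> Aut M"
  shows "mp M (inv_aut M f)" "AE x in M. inv_aut M f (f x) = x" "AE x in M. f (inv_aut M f x) = x"
proof -
  have "\<exists>g. mp M g \<and> (AE x in M. g (f x) = x) \<and> (AE x in M. f (g x) = x)"
    using assms unfolding Aut_def by blast
  from someI_ex[OF this, folded inv_aut_def] show "mp M (inv_aut M f)" "AE x in M. inv_aut M f (f x) = x" "AE x in M. f (inv_aut M f x) = x"
    by auto
qed

definition img_dist :: "'a measure \<Rightarrow> ('a \<Rightarrow> 'a) \<Rightarrow> ('a \<Rightarrow> 'a) \<Rightarrow> 'a set \<Rightarrow> real" where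
  "img_dist M f f' A = measure M (sym_diff (img M f A) (img M f' A))"

lemma img_dist_eq_dis: "img_dist M f f' A = dis M (\<lambda>x. inv_aut M f x \<in> A) (\<lambda>x. inv_aut M f' x \<in> A)"
  unfolding img_dist_def dis_def img_def by (rule arg_cong[where f="measure M"]) auto

lemma inv_aut_measurable: "f \<in> Aut M \<Longrightarrow> inv_aut M f \<in> M \<rightarrow>\<^sub>M M"
  using inv_aut(1) unfolding mp_def by blast

lemma img_dist_triangle:
  assumes "finite_measure M" "f \<in> Aut M" "g \<in> Aut M" "h \<in> Aut M" "A \<in> sets M"
  shows "img_dist M f h A \<le> img_dist M f g A + img_dist M g h A"
proof -
  note [measurable] = inv_aut_measurable[OF assms(2)] inv_aut_measurable[OF assms(3)]
    inv_aut_measurable[OF assms(4)] assms(5)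
  show ?thesis unfolding img_dist_eq_dis by (rule finite_measure.dis_triangle[OF assms(1)]) measurable
qed

lemma inv_aut_action:
  assumes S: "S \<in> actions M K" and K: "add_subgroup K" and g: "g \<in> K"
  shows "AE x in M. inv_aut M (S g) x = S (- g) x"
proof -
  note ng = add_subgroupD(3)[OF K g]
  have "AE x in M. S (g + - g) x = S g (S (- g) x)" by (rule actionsD(5)[OF S g ng])
  then have "AE x in M. S g (S (- g) x) = x"
    using actions_zero[OF S add_subgroupD(1)[OF K]] by eventually_elim simp
  moreover have "AE x in M. inv_aut M (S g) (S g (S (- g) x)) = S (- g) x"
    by (rule mp_AE[OF actionsD(2)[OF S ng] inv_aut(2)[OF actionsD(1)[OF S g]]])
  ultimately show ?thesis by eventually_elim simp
qed

text \<open>The image of a set under \<open>S g\<close> is its preimage under \<open>S (- g)\<close>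
  modulo null sets. This links the weak topology, defined by images, to \<open>close\<close>,
  defined by preimages.\<close>

lemma img_dist_action:
  assumes S: "S \<in> actions M K" and K: "add_subgroup K" and T: "T \<in> actions M L" and L: "add_subgroup L"
    and g: "g \<in> K" "h \<in> L" and [measurable]: "A \<in> sets M"
  shows "img_dist M (S g) (T h) A = dis M (\<lambda>x. S (- g) x \<in> A) (\<lambda>x. T (- h) x \<in> A)"
proof -
  note [measurable] = inv_aut_measurable[OF actionsD(1)[OF S g(1)]] inv_aut_measurable[OF actionsD(1)[OF T g(2)]]
    actionsD(3)[OF S add_subgroupD(3)[OF K g(1)]] actionsD(3)[OF T add_subgroupD(3)[OF L g(2)]]
  show ?thesis
    unfolding img_dist_eq_dis
  proof (rule dis_cong_AE)
    show "AE x in M. (inv_aut M (S g) x \<in> A) = (S (- g) x \<in> A)"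
      using inv_aut_action[OF S K g(1)] by eventually_elim simp
    show "AE x in M. (inv_aut M (T h) x \<in> A) = (T (- h) x \<in> A)"
      using inv_aut_action[OF T L g(2)] by eventually_elim simp
  qed measurable
qed

lemma topspace_weak_top: "topspace (weak_top M) = Aut M"
  unfolding weak_top_def topology_generated_by_topspace by auto

lemma openin_weak_ball:
  assumes "f \<in> Aut M" "A \<in> sets M" "0 < e"
  shows "openin (weak_top M) {f' \<in> Aut M. img_dist M f' f A < e}"
  unfolding weak_top_def img_dist_def
  by (rule topology_generated_by_Basis) (use assms in blast)

text \<open>Subbasic sets may be balls around other centres; the triangle inequality recentres them
  at \<open>f\<close>. Finite intersections unite the families of sets and take the smaller
  radius.\<close>

lemma weak_top_nbhd:
  assumes M: "finite_measure M" and U: "openin (weak_top M) U" and f: "f \<in> U"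
  shows "\<exists>\<A> e. finite \<A> \<and> \<A> \<subseteq> sets M \<and> 0 < e \<and>
    (\<forall>f'\<in>Aut M. (\<forall>A\<in>\<A>. img_dist M f' f A < e) \<longrightarrow> f' \<in> U)"
proof -
  have "generate_topology_on (insert (Aut M) {{S \<in> Aut M. measure M (sym_diff (img M S A) (img M T A)) < e} | T A e.
        T \<in> Aut M \<and> A \<in> sets M \<and> e > 0}) U"
    using U unfolding weak_top_def openin_topology_generated_by_iff .
  then show ?thesis using f
  proof (induction rule: generate_topology_on.induct)
    case Empty
    then show ?case by simp
  next
    case (Int U V)
    then obtain \<A> d where U: "finite \<A>" "\<A> \<subseteq> sets M" "0 < d"
      "\<And>f'. f' \<in> Aut M \<Longrightarrow> \<forall>A\<in>\<A>. img_dist M f' f A < d \<Longrightarrow> f' \<in> U" by blast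
    from Int obtain \<B> e where V: "finite \<B>" "\<B> \<subseteq> sets M" "0 < e"
      "\<And>f'. f' \<in> Aut M \<Longrightarrow> \<forall>A\<in>\<B>. img_dist M f' f A < e \<Longrightarrow> f' \<in> V" by blast
    have "f' \<in> U \<inter> V" if f': "f' \<in> Aut M" "\<forall>A\<in>\<A> \<union> \<B>. img_dist M f' f A < min d e" for f'
      using U(4)[OF f'(1)] V(4)[OF f'(1)] f'(2) by simp
    then show ?case
      using U V by (intro exI[of _ "\<A> \<union> \<B>"] exI[of _ "min d e"]) simp
  next
    case (UN \<U>)
    then obtain U where U: "U \<in> \<U>" "f \<in> U" by blast
    from UN.IH[OF this] obtain \<A> e where "finite \<A>" "\<A> \<subseteq> sets M" "0 < e"
      "\<forall>f'\<in>Aut M. (\<forall>A\<in>\<A>. img_dist M f' f A < e) \<longrightarrow> f' \<in> U" by blast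
    with U(1) show ?case by (intro exI[of _ \<A>] exI[of _ e]) blast
  next
    case (Basis U)
    then consider "U = Aut M" | T A e where "U = {S \<in> Aut M. img_dist M S T A < e}"
        "T \<in> Aut M" "A \<in> sets M" "e > 0"
      unfolding img_dist_def by blast
    then show ?case
    proof cases
      case 1
      then show ?thesis by (intro exI[of _ "{}"] exI[of _ 1]) simp
    next
      case (2 T A e)
      then have f: "f \<in> Aut M" "img_dist M f T A < e" using Basis by auto
      have "f' \<in> U" if f': "f' \<in> Aut M" "img_dist M f' f A < e - img_dist M f T A" for f'
        using img_dist_triangle[OF M f'(1) f(1) 2(2,3)] f' 2(1) by simp
      then show ?thesis
        using 2 f by (intro exI[of _ "{A}"] exI[of _ "e - img_dist M f T A"]) simp
    qed
  qed
qed

lemma topspace_actions_top: "topspace (actions_top M K) = actions M K"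
  unfolding actions_top_def by (auto simp: topspace_weak_top actions_def)

text \<open>A basic open set of the product restricts finitely many coordinates, and each of these
  contains a weak ball around \<open>S i\<close>.\<close>

lemma actions_top_nbhd:
  assumes M: "finite_measure M" and K: "add_subgroup K" and U: "openin (actions_top M K) U" and S: "S \<in> U"
  obtains E \<A> e where "test M K E \<A> e" "\<And>S'. S' \<in> actions M K \<Longrightarrow> close M E \<A> e S' S \<Longrightarrow> S' \<in> U"
proof -
  have SK: "S \<in> actions M K" using openin_subset[OF U] S topspace_actions_top by blast
  obtain O' where O': "openin (product_topology (\<lambda>_. weak_top M) K) O'" "U = O' \<inter> actions M K"
    using U unfolding actions_top_def openin_subtopology by blast
  then have "S \<in> O'" using S by blast
  from O'(1)[unfolded openin_product_topology_alt topspace_weak_top, rule_format, OF this]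
  obtain W where W: "finite {i \<in> K. W i \<noteq> Aut M}" "\<And>i. i \<in> K \<Longrightarrow> openin (weak_top M) (W i)"
    "S \<in> PiE K W" "PiE K W \<subseteq> O'"
    by (elim exE conjE) blast
  define E where "E = {i \<in> K. W i \<noteq> Aut M}"
  have "\<exists>\<A> e. finite \<A> \<and> \<A> \<subseteq> sets M \<and> 0 < e \<and>
    (\<forall>f'\<in>Aut M. (\<forall>A\<in>\<A>. img_dist M f' (S i) A < e) \<longrightarrow> f' \<in> W i)" if "i \<in> E" for i
    using that W by (intro weak_top_nbhd[OF M]) (auto simp: E_def)
  then obtain \<A> e where *: "\<And>i. i \<in> E \<Longrightarrow> finite (\<A> i) \<and> \<A> i \<subseteq> sets M \<and> 0 < e i \<and>
    (\<forall>f'\<in>Aut M. (\<forall>A\<in>\<A> i. img_dist M f' (S i) A < e i) \<longrightarrow> f' \<in> W i)"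
    by metis
  have E: "finite E" "E \<subseteq> K" using W(1) unfolding E_def by auto
  \<comment> \<open>The element 1 keeps the minimum defined when no coordinate is
    restricted.\<close>
  define d where "d = Min (insert 1 (e ` E))"
  have d: "0 < d" "\<And>i. i \<in> E \<Longrightarrow> d \<le> e i"
    using E(1) * unfolding d_def by auto
  have "test M K (uminus ` E) (\<Union>i\<in>E. \<A> i) d"
    using E d(1) * add_subgroupD(3)[OF K] by auto
  moreover have "S' \<in> U" if S': "S' \<in> actions M K" and cl: "close M (uminus ` E) (\<Union>i\<in>E. \<A> i) d S' S" for S'
  proof -
    have "S' i \<in> W i" if i: "i \<in> K" for i
    proof (cases "i \<in> E")
      case True
      have "img_dist M (S' i) (S i) A < e i" if A: "A \<in> \<A> i" for A
      proof -
        have "A \<in> sets M" using * True A by blast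
        from img_dist_action[OF S' K SK K i i this]
        have "img_dist M (S' i) (S i) A = dis M (\<lambda>x. S' (- i) x \<in> A) (\<lambda>x. S (- i) x \<in> A)" .
        also have "\<dots> < d" using cl True A unfolding close_def by blast
        also have "\<dots> \<le> e i" by (rule d(2)[OF True])
        finally show ?thesis .
      qed
      then show ?thesis using *[OF True] actionsD(1)[OF S' i] by blast
    next
      case False
      then show ?thesis using i actionsD(1)[OF S' i] unfolding E_def by blast
    qed
    moreover have "S' \<in> extensional K" using S' unfolding actions_def by (auto simp: PiE_def)
    ultimately have "S' \<in> PiE K W" by (auto simp: PiE_def)
    then show ?thesis using W(4) S' O'(2) by blast
  qed
  ultimately show ?thesis by (rule that)
qed

lemma openin_close:
  assumes M: "finite_measure M" and K: "add_subgroup K" and t: "test M K E \<A> e" and T: "T \<in> actions M K"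
  shows "openin (actions_top M K) {S \<in> actions M K. close M E \<A> e S T}"
proof -
  \<comment> \<open>The coordinate is \<open>- g\<close> because images under \<open>S (- g)\<close>
    are preimages under \<open>S g\<close>.\<close>
  define W where "W = (\<lambda>(g, A). {S \<in> topspace (product_topology (\<lambda>_. weak_top M) K).
    S (- g) \<in> {f \<in> Aut M. img_dist M f (T (- g)) A < e}})"
  have W: "openin (product_topology (\<lambda>_. weak_top M) K) (W z)" if z: "z \<in> E \<times> \<A>" for z
  proof -
    obtain g A where z: "z = (g, A)" "g \<in> E" "A \<in> \<A>" using z by blast
    have ng: "- g \<in> K" using z t add_subgroupD(3)[OF K] by blast
    have "openin (weak_top M) {f \<in> Aut M. img_dist M f (T (- g)) A < e}"
      by (rule openin_weak_ball[OF actionsD(1)[OF T ng]]) (use t z in auto)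
    from openin_continuous_map_preimage[OF continuous_map_product_projection[OF ng] this]
    show ?thesis unfolding z W_def by simp
  qed
  \<comment> \<open>Intersecting with the whole space covers the case of an empty test.\<close>
  have "openin (product_topology (\<lambda>_. weak_top M) K)
      (topspace (product_topology (\<lambda>_. weak_top M) K) \<inter> \<Inter> (W ` (E \<times> \<A>)))"
  proof (rule openin_Int_Inter)
    show "finite (W ` (E \<times> \<A>))" using t by simp
  qed (use W in \<open>auto simp del: topspace_product_topology\<close>)
  moreover have "{S \<in> actions M K. close M E \<A> e S T}
      = (topspace (product_topology (\<lambda>_. weak_top M) K) \<inter> \<Inter> (W ` (E \<times> \<A>))) \<inter> actions M K"
  proof -
    have "close M E \<A> e S T \<longleftrightarrow>
        S \<in> topspace (product_topology (\<lambda>_. weak_top M) K) \<inter> \<Inter> (W ` (E \<times> \<A>))"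
      if S: "S \<in> actions M K" for S
    proof -
      have top: "S \<in> topspace (product_topology (\<lambda>_. weak_top M) K)"
        using S unfolding actions_def by (simp add: topspace_weak_top)
      have "S \<in> W (g, A) \<longleftrightarrow> dis M (\<lambda>x. S g x \<in> A) (\<lambda>x. T g x \<in> A) < e"
        if "g \<in> E" "A \<in> \<A>" for g A
      proof -
        have ng: "- g \<in> K" and A: "A \<in> sets M" using that t add_subgroupD(3)[OF K] by blast+
        show ?thesis
          unfolding W_def using top actionsD(1)[OF S ng] img_dist_action[OF S K T K ng ng A] by simp
      qed
      then show ?thesis using top unfolding close_def by auto
    qed
    then show ?thesis by blast
  qed
  ultimately show ?thesis unfolding actions_top_def openin_subtopology by blast
qed

section \<open>From equal closures to local density\<close>

text \<open>\<open>T g\<close> lies in the closure of the \<open>T h\<close> with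
  \<open>h \<in> H\<close>, so some \<open>T h\<close> is in a given weak ball around it; by
  invariance the distance of \<open>T h\<close> and \<open>T g\<close> on \<open>A\<close> is the
  displacement of \<open>A\<close> by \<open>T (g - h)\<close>.\<close>

lemma dense_in_orbitI:
  assumes M: "finite_measure M" and T: "T \<in> actions M UNIV" and H: "add_subgroup H"
    and cl: "weak_top M closure_of (range T) = weak_top M closure_of (T ` H)"
  shows "dense_in_orbit M T H"
  unfolding dense_in_orbit_def
proof (intro allI impI)
  fix g \<A> and e :: real assume t: "finite \<A> \<and> \<A> \<subseteq> sets M \<and> 0 < e"
  have G: "add_subgroup (UNIV :: 'b set)" unfolding add_subgroup_def by simp
  have T': "mp_action M UNIV T" by (rule actions_mp_action[OF T UNIV_I])
  have TA: "T g \<in> Aut M" for g by (rule actionsD(1)[OF T UNIV_I])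
  have "range T \<subseteq> weak_top M closure_of (range T)"
    by (rule closure_of_subset) (use TA in \<open>auto simp: topspace_weak_top\<close>)
  then have "T g \<in> weak_top M closure_of (T ` H)" using cl by blast
  moreover
  let ?B = "\<lambda>A. {f \<in> Aut M. img_dist M f (T g) A < e}"
  have "openin (weak_top M) (Aut M \<inter> \<Inter> (?B ` \<A>))"
  proof (rule openin_Int_Inter)
    show "openin (weak_top M) (Aut M)" using openin_topspace[of "weak_top M"] topspace_weak_top by metis
    show "openin (weak_top M) X" if "X \<in> ?B ` \<A>" for X
      using that t openin_weak_ball[OF TA] by auto
  qed (use t in simp)
  moreover have "T g \<in> Aut M \<inter> \<Inter> (?B ` \<A>)"
    using TA t by (simp add: img_dist_def)
  ultimately obtain h where h: "h \<in> H" "T h \<in> Aut M \<inter> \<Inter> (?B ` \<A>)"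
    unfolding in_closure_of by blast
  have "displacement M (T (g - h)) A < e" if A: "A \<in> \<A>" for A
  proof -
    have A': "A \<in> sets M" using A t by blast
    have "displacement M (T (g - h)) A = img_dist M (T h) (T g) A"
      unfolding img_dist_action[OF T G T G UNIV_I UNIV_I A'] dis_action[OF T' A'] by simp
    also have "\<dots> < e" using h(2) A by blast
    finally show ?thesis .
  qed
  with h(1) show "\<exists>h\<in>H. \<forall>A\<in>\<A>. displacement M (T (g - h)) A < e" by blast
qed

theorem theorem4p1:
  fixes M :: "'a::polish_space measure"
    and T :: "'g::{ab_group_add, countable} \<Rightarrow> 'a \<Rightarrow> 'a"
    and H :: "'g set"
  assumes "std_atomless_prob M"
    and "0 \<in> H" and "\<And>g h. g \<in> H \<Longrightarrow> h \<in> H \<Longrightarrow> g + h \<in> H" and "\<And>g. g \<in> H \<Longrightarrow> - g \<in> H"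
    and "T \<in> actions M UNIV"
    and "weak_top M closure_of (range T) = weak_top M closure_of (T ` H)"
  shows "locally_dense_point (actions_top M UNIV) (actions_top M H) (\<lambda>S. restrict S H) T"
  unfolding locally_dense_point_def
proof (intro allI impI, elim conjE)
  fix U assume U: "openin (actions_top M UNIV) U" and TU: "T \<in> U"
  note M' = std_atomless_probD[OF assms(1)]
  have M: "finite_measure M" by (rule prob_space.finite_measure[OF M'(1)])
  have H: "add_subgroup H" using assms(2-4) unfolding add_subgroup_def by blast
  have G: "add_subgroup (UNIV :: 'g set)" unfolding add_subgroup_def by simp
  have T': "mp_action M UNIV T" by (rule actions_mp_action[OF assms(5) UNIV_I])
  have TH: "restrict T H \<in> actions M H" by (rule actions_restrict[OF assms(5) _ H]) simp
  have close_TH: "close M E \<A> e S (restrict T H) \<longleftrightarrow> close M E \<A> e S T" if "E \<subseteq> H" for E \<A> e S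
    unfolding close_def using that by (auto simp: subset_iff)
  obtain E \<A> e where t: "test M UNIV E \<A> e"
    and EU: "\<And>S. S \<in> actions M UNIV \<Longrightarrow> close M E \<A> e S T \<Longrightarrow> S \<in> U"
    using actions_top_nbhd[OF M G U TU] by blast
  have "finite E" using t by blast
  from extension_finitely_generated[OF M'(1,4,5) T' H dense_in_orbitI[OF M assms(5) H assms(6)] this]
  obtain K where K: "add_subgroup K" "H \<subseteq> K" "E \<subseteq> K" "locally_dense_extension M T H K" by blast
  \<comment> \<open>The other half of \<open>e\<close> is reserved for the error of the coinduction
    from \<open>K\<close> to the whole group.\<close>
  have "test M K E \<A> (e / 2)" using t K(3) by simp
  from locally_dense_extensionE[OF K(4) this] obtain E1 \<A>1 e1 where t1: "test M H E1 \<A>1 e1"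
    and ext: "\<And>S. S \<in> actions M H \<Longrightarrow> close M E1 \<A>1 e1 S T \<Longrightarrow> approx_extends M T H K E \<A> (e / 2) S"
    by blast
  define V where "V = {S \<in> actions M H. close M E1 \<A>1 e1 S (restrict T H)}"
  have V: "openin (actions_top M H) V" unfolding V_def by (rule openin_close[OF M H t1 TH])
  have TV: "restrict T H \<in> V" unfolding V_def using TH close_refl t1 by blast
  have "V \<subseteq> actions_top M H closure_of ((\<lambda>S. restrict S H) ` U \<inter> V)"
  proof
    fix S assume S: "S \<in> V"
    then have SH: "S \<in> actions M H" and "close M E1 \<A>1 e1 S (restrict T H)" unfolding V_def by auto
    then have S_ext: "approx_extends M T H K E \<A> (e / 2) S" using ext close_TH t1 by blast
    show "S \<in> actions_top M H closure_of ((\<lambda>S. restrict S H) ` U \<inter> V)"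
      unfolding in_closure_of topspace_actions_top
    proof (intro conjI allI impI, rule SH, elim conjE)
      fix W assume "S \<in> W" "openin (actions_top M H) W"
      \<comment> \<open>The approximating restriction must lie in \<open>V\<close> as well, since
        the closure is taken of the part of the image inside \<open>V\<close>.\<close>
      then have W: "openin (actions_top M H) (W \<inter> V)" "S \<in> W \<inter> V" using V S by auto
      obtain E2 \<A>2 e2 where t2: "test M H E2 \<A>2 e2"
        and EW: "\<And>S'. S' \<in> actions M H \<Longrightarrow> close M E2 \<A>2 e2 S' S \<Longrightarrow> S' \<in> W \<inter> V"
        using actions_top_nbhd[OF M H W] by blast
      have "test M H E2 \<A>2 (e2 / 2)" using t2 by simp
      from approx_extendsE[OF S_ext this] obtain R where R: "R \<in> actions M K"
        "close M E \<A> (e / 2) R T" "close M E2 \<A>2 (e2 / 2) R S" .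
      \<comment> \<open>One tolerance serves both purposes: staying near \<open>T\<close> on
        \<open>E\<close> and near \<open>S\<close> on \<open>E2\<close>.\<close>
      define d where "d = min (e / 2) (e2 / 2)"
      have "test M K (E \<union> E2) (\<A> \<union> \<A>2) d" using t t2 K unfolding d_def by auto
      from coinduced_extension[OF assms(1) K(1) R(1) this]
      obtain R' where R': "R' \<in> actions M UNIV" "close M (E \<union> E2) (\<A> \<union> \<A>2) d R' R" by blast
      have cl: "close M E \<A> (e / 2) R' R" "close M E2 \<A>2 (e2 / 2) R' R"
        by (rule close_mono[OF R'(2)]; simp add: d_def)+
      have E2H: "E2 \<subseteq> H" using t2 by blast
      note m = actionsD(3)[OF R(1)] actionsD(3)[OF R'(1) UNIV_I] actionsD(3)[OF assms(5) UNIV_I] actionsD(3)[OF SH]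
      have "close M E \<A> (e / 2 + e / 2) R' T"
        by (rule close_trans[OF M _ _ _ _ cl(1) R(2)]) (use t K(3) m in auto)
      then have "R' \<in> U" by (intro EU R'(1)) simp
      moreover have "close M E2 \<A>2 (e2 / 2 + e2 / 2) R' S"
        by (rule close_trans[OF M _ _ _ _ cl(2) R(3)]) (use t2 K(2) m in auto)
      then have "close M E2 \<A>2 e2 (restrict R' H) S"
        unfolding close_def using E2H by (auto simp: subset_iff)
      then have "restrict R' H \<in> W \<inter> V"
        by (intro EW actions_restrict[OF R'(1) _ H]) simp_all
      ultimately show "\<exists>y. y \<in> (\<lambda>S. restrict S H) ` U \<inter> V \<and> y \<in> W" by blast
    qed
  qed
  with V TV show "\<exists>V. openin (actions_top M H) V \<and> restrict T H \<in> V \<and>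
      V \<subseteq> actions_top M H closure_of ((\<lambda>S. restrict S H) ` U \<inter> V)"
    by blast
qed

end
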